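(* Let $k\in\mathbb{N}$, let $\alpha$, $\beta$ be two inner functions and let $\varphi\in L^2$. If $\varphi\in \overline{\alpha H^2}+ \overline{z}^{k-1}(W_k^*\beta )H^2$, then $U_{\varphi}^{\alpha,\beta}=0$.
   Context: $\mathbb{T}$ is the unit circle, $L^2=L^2(\mathbb{T})$, $H^2\subset L^2$ the Hardy space of the unit disk. $\mathbb{N}=\{1,2,\dots\}$. An inner function is a bounded analytic function in the disk with boundary values of modulus one a.e. on $\mathbb{T}$. $K_\alpha=H^2\ominus\alpha H^2$, $K_\alpha^\infty=K_\alpha\cap H^\infty$ (dense in $K_\alpha$), $P_\alpha$ is the orthogonal projection of $L^2$ onto $K_\alpha$. $W_k$ is the bounded operator on $L^2$ with $W_k(z^n)=z^{n/k}$ if $k$ divides $n$ and $W_k(z^n)=0$ otherwise ($n\in\mathbb{Z}$); its adjoint is $W_k^*f(z)=f(z^k)$. For $\varphi\in L^2$, $U_\varphi^{\alpha,\beta}f=P_\beta W_k(\varphi f)$ for $f\in K_\alpha^\infty$. $\overline{\alpha H^2}=\{\overline{\alpha h}:h\in H^2\}$ (complex conjugates), and $\overline{z}$ is the function $z\mapsto\overline z$ on $\mathbb{T}$. *)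

theory Defs
  imports "HOL-Analysis.Analysis"
begin

text \<open>
  Elements of \<open>L\<^sup>2\<close> are represented by square-integrable functions on the unit circle; equality in
  \<open>L\<^sup>2\<close> is equality almost everywhere. Values of a function off the circle are irrelevant.
\<close>

definition circ :: "complex measure" where
  "circ = distr (uniform_measure lborel {0..<2 * pi}) (restrict_space borel (sphere 0 1)) cis"

definition L2 :: "(complex \<Rightarrow> complex) set" where
  "L2 = {f \<in> borel_measurable circ. integrable circ (\<lambda>z. (norm (f z))\<^sup>2)}"

definition ip :: "(complex \<Rightarrow> complex) \<Rightarrow> (complex \<Rightarrow> complex) \<Rightarrow> complex" where
  "ip f g = (\<integral>z. f z * cnj (g z) \<partial>circ)"

definition L2norm :: "(complex \<Rightarrow> complex) \<Rightarrow> real" where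
  "L2norm f = sqrt (\<integral>z. (norm (f z))\<^sup>2 \<partial>circ)"

definition has_boundary_function :: "(complex \<Rightarrow> complex) \<Rightarrow> (complex \<Rightarrow> complex) \<Rightarrow> bool" where
  "has_boundary_function F f \<longleftrightarrow>
     (AE z in circ. ((\<lambda>r. F (of_real r * z)) \<longlongrightarrow> f z) (at_left (1::real)))"

text \<open>
  The Hardy spaces are defined on the disk and identified with spaces of boundary functions.
\<close>

definition H2 :: "(complex \<Rightarrow> complex) set" where
  "H2 = {f \<in> L2. \<exists>F. F holomorphic_on ball 0 1 \<and>
           (\<exists>C. \<forall>r\<in>{0..<1::real}. (\<integral>z. (norm (F (of_real r * z)))\<^sup>2 \<partial>circ) \<le> C) \<and>
           has_boundary_function F f}"

definition Hinf :: "(complex \<Rightarrow> complex) set" where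
  "Hinf = {f \<in> L2. \<exists>F. F holomorphic_on ball 0 1 \<and> bounded (F ` ball 0 1) \<and>
             has_boundary_function F f}"

definition inner_function :: "(complex \<Rightarrow> complex) \<Rightarrow> bool" where
  "inner_function \<alpha> \<longleftrightarrow> \<alpha> holomorphic_on ball 0 1 \<and> bounded (\<alpha> ` ball 0 1) \<and>
     (AE z in circ. \<exists>w. norm w = 1 \<and> ((\<lambda>r. \<alpha> (of_real r * z)) \<longlongrightarrow> w) (at_left (1::real)))"

definition bdry :: "(complex \<Rightarrow> complex) \<Rightarrow> complex \<Rightarrow> complex" where
  "bdry F z = Lim (at_left (1::real)) (\<lambda>r. F (of_real r * z))"

text \<open>
  The space \<open>u H\<^sup>2\<close> for a function \<open>u\<close> on the circle. It is closed under equality almost everywhere,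
  as are all the spaces below.
\<close>

definition mult_H2 :: "(complex \<Rightarrow> complex) \<Rightarrow> (complex \<Rightarrow> complex) set" where
  "mult_H2 u = {g \<in> L2. \<exists>h\<in>H2. AE z in circ. g z = u z * h z}"

definition K :: "(complex \<Rightarrow> complex) \<Rightarrow> (complex \<Rightarrow> complex) set" where
  "K \<alpha> = {f \<in> H2. \<forall>g\<in>mult_H2 (bdry \<alpha>). ip f g = 0}"

definition Kinf :: "(complex \<Rightarrow> complex) \<Rightarrow> (complex \<Rightarrow> complex) set" where
  "Kinf \<alpha> = K \<alpha> \<inter> Hinf"

text \<open>
  Orthogonal projection onto a closed subspace \<open>M\<close> of \<open>L\<^sup>2\<close>: the element of \<open>M\<close> is determined only
  up to equality almost everywhere, and \<open>SOME\<close> picks a representative.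
\<close>

definition proj :: "(complex \<Rightarrow> complex) set \<Rightarrow> (complex \<Rightarrow> complex) \<Rightarrow> complex \<Rightarrow> complex" where
  "proj M f = (SOME g. g \<in> M \<and> (\<forall>h\<in>M. ip (\<lambda>z. f z - g z) h = 0))"

text \<open>
  Linearity and boundedness imply that the operator respects equality almost everywhere.
\<close>

definition bounded_L2_operator :: "((complex \<Rightarrow> complex) \<Rightarrow> complex \<Rightarrow> complex) \<Rightarrow> bool" where
  "bounded_L2_operator T \<longleftrightarrow>
     (\<forall>f\<in>L2. T f \<in> L2) \<and>
     (\<forall>f\<in>L2. \<forall>g\<in>L2. \<forall>a b. AE z in circ. T (\<lambda>w. a * f w + b * g w) z = a * T f z + b * T g z) \<and>
     (\<exists>C. \<forall>f\<in>L2. L2norm (T f) \<le> C * L2norm f)"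

definition is_W :: "nat \<Rightarrow> ((complex \<Rightarrow> complex) \<Rightarrow> complex \<Rightarrow> complex) \<Rightarrow> bool" where
  "is_W k T \<longleftrightarrow> bounded_L2_operator T \<and>
     (\<forall>n::int. AE z in circ.
        T (\<lambda>w. w powi n) z = (if int k dvd n then z powi (n div int k) else 0))"

definition W :: "nat \<Rightarrow> (complex \<Rightarrow> complex) \<Rightarrow> complex \<Rightarrow> complex" where
  "W k = (SOME T. is_W k T)"

definition W_adj :: "nat \<Rightarrow> (complex \<Rightarrow> complex) \<Rightarrow> complex \<Rightarrow> complex" where
  "W_adj k f z = f (z ^ k)"

text \<open>
  The inner function \<open>\<alpha>\<close> enters \<open>U\<close> only through its domain \<open>Kinf \<alpha>\<close>.
\<close>

definition U :: "nat \<Rightarrow> (complex \<Rightarrow> complex) \<Rightarrow> (complex \<Rightarrow> complex) \<Rightarrow> (complex \<Rightarrow> complex) \<Rightarrow> complex \<Rightarrow> complex" where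
  "U k \<beta> \<phi> f = proj (K \<beta>) (W k (\<lambda>z. \<phi> z * f z))"

text \<open>
  Well-definedness of \<open>W\<close>: averaging over the \<open>k\<close>-th roots gives an operator with the defining
  properties, so the choice in \<open>W\<close> is not vacuous.
\<close>


lemma space_circ [simp]: "space circ = sphere 0 1"
  by (simp add: circ_def space_restrict_space)

lemma sets_circ [simp, measurable_cong]: "sets circ = sets (restrict_space borel (sphere 0 1))"
  by (simp add: circ_def)

lemma cis_measurable: "cis \<in> borel \<rightarrow>\<^sub>M restrict_space borel (sphere 0 1)"
  by (intro measurable_restrict_space2 borel_measurable_continuous_onI continuous_intros) auto

lemma nn_integral_circ:
  assumes "f \<in> borel_measurable circ"
  shows "(\<integral>\<^sup>+z. f z \<partial>circ)
    = (\<integral>\<^sup>+t. f (cis t) * indicator {0..<2 * pi} t \<partial>lborel) / ennreal (2 * pi)"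
proof -
  have [measurable]: "cis \<in> borel \<rightarrow>\<^sub>M circ"
    using cis_measurable by (simp cong: measurable_cong_sets)
  have "(\<integral>\<^sup>+z. f z \<partial>circ) = (\<integral>\<^sup>+t. f (cis t) \<partial>uniform_measure lborel {0..<2 * pi})"
    unfolding circ_def using assms cis_measurable
    by (subst nn_integral_distr) (auto simp: uniform_measure_def cong: measurable_cong_sets)
  also have "\<dots> = (\<integral>\<^sup>+t. f (cis t) * indicator {0..<2 * pi} t \<partial>lborel) / ennreal (2 * pi)"
    using assms by (subst nn_integral_uniform_measure) (auto simp: top_unique intro!: measurable_compose[of cis _ circ])
  finally show ?thesis .
qed

lemma borel_measurable_Arg2pi [measurable]: "Arg2pi \<in> borel_measurable borel"
proof -
  have "(\<lambda>z. if z \<in> \<real>\<^sub>\<ge>\<^sub>0 then 0 else Arg2pi z) \<in> borel_measurable borel"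
    by (intro borel_measurable_continuous_on_if continuous_at_imp_continuous_on)
      (auto intro: continuous_at_Arg2pi)
  moreover have "(\<lambda>z. if z \<in> \<real>\<^sub>\<ge>\<^sub>0 then 0 else Arg2pi z) = Arg2pi"
    by (auto simp: fun_eq_iff Arg2pi_eq_0 complex_nonneg_Reals_iff complex_is_Real_iff)
  ultimately show ?thesis by simp
qed

definition kth_root :: "nat \<Rightarrow> nat \<Rightarrow> complex \<Rightarrow> complex" where
  "kth_root k j z = cis ((Arg2pi z + 2 * pi * real j) / real k)"

definition W_avg :: "nat \<Rightarrow> (complex \<Rightarrow> complex) \<Rightarrow> complex \<Rightarrow> complex" where
  "W_avg k f z = (\<Sum>j<k. f (kth_root k j z)) / of_nat k"

lemma kth_root_measurable [measurable]: "kth_root k j \<in> circ \<rightarrow>\<^sub>M circ"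
proof -
  have "(\<lambda>z. (Arg2pi z + 2 * pi * real j) / real k) \<in> circ \<rightarrow>\<^sub>M borel"
    by (subst measurable_cong_sets[OF sets_circ refl]) (auto intro!: measurable_restrict_space1)
  from measurable_compose[OF this cis_measurable]
  show ?thesis by (simp add: kth_root_def[abs_def] cong: measurable_cong_sets)
qed

lemma Arg2pi_cis: "0 \<le> t \<Longrightarrow> t < 2 * pi \<Longrightarrow> Arg2pi (cis t) = t"
  by (rule Arg2pi_unique[of 1]) (auto simp: cis_conv_exp)

lemma nn_integral_kth_roots:
  assumes k: "k \<ge> 1" and f [measurable]: "f \<in> borel_measurable circ"
  shows "(\<Sum>j<k. \<integral>\<^sup>+z. f (kth_root k j z) \<partial>circ) = of_nat k * (\<integral>\<^sup>+z. f z \<partial>circ)"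
proof -
  define I where "I j = {2 * pi * real j / real k ..< 2 * pi * real (Suc j) / real k}" for j
  define F where "F t = f (cis t)" for t
  have [measurable]: "F \<in> borel_measurable borel"
    using f cis_measurable unfolding F_def[abs_def]
    by (auto intro!: measurable_compose[of cis _ circ] cong: measurable_cong_sets)
  have [measurable]: "I j \<in> sets borel" for j by (simp add: I_def)
  have meas: "(\<lambda>z. f (kth_root k j z)) \<in> borel_measurable circ" for j by measurable
  have "(\<integral>\<^sup>+t. f (kth_root k j (cis t)) * indicator {0..<2 * pi} t \<partial>lborel)
      = of_nat k * (\<integral>\<^sup>+t. F t * indicator (I j) t \<partial>lborel)" for j
  proof -
    have eq: "indicator (I j) (2 * pi * real j / real k + (1 / real k) * t)
        = (indicator {0..<2 * pi} t :: ennreal)" for t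
      using k by (auto simp: I_def indicator_def field_simps)
    have eq2: "f (kth_root k j (cis t)) = F (2 * pi * real j / real k + t / real k)"
      if "0 \<le> t" "t < 2 * pi" for t
      using that k by (auto simp: kth_root_def F_def Arg2pi_cis add_divide_distrib add.commute)
    have "(\<integral>\<^sup>+t. F t * indicator (I j) t \<partial>lborel) = ennreal (1 / real k) *
       (\<integral>\<^sup>+t. F (2 * pi * real j / real k + (1 / real k) * t) * indicator {0..<2 * pi} t \<partial>lborel)"
      using k unfolding eq[symmetric]
      by (subst nn_integral_real_affine[where c = "1 / real k" and t = "2 * pi * real j / real k"]) auto
    also have "(\<integral>\<^sup>+t. F (2 * pi * real j / real k + (1 / real k) * t) * indicator {0..<2 * pi} t \<partial>lborel)
       = (\<integral>\<^sup>+t. f (kth_root k j (cis t)) * indicator {0..<2 * pi} t \<partial>lborel)"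
      using eq2 by (intro nn_integral_cong) (auto simp: indicator_def)
    finally have *: "(\<integral>\<^sup>+t. F t * indicator (I j) t \<partial>lborel) = ennreal (1 / real k) * \<dots>" .
    have "of_nat k * ennreal (1 / real k) = 1"
      using k by (simp add: ennreal_of_nat_eq_real_of_nat flip: ennreal_mult)
    then show ?thesis unfolding * by (simp flip: mult.assoc)
  qed
  then have "(\<Sum>j<k. \<integral>\<^sup>+z. f (kth_root k j z) \<partial>circ)
     = (\<Sum>j<k. of_nat k * (\<integral>\<^sup>+t. F t * indicator (I j) t \<partial>lborel) / ennreal (2 * pi))"
    by (simp add: nn_integral_circ[OF meas])
  also have "\<dots> = of_nat k * (\<Sum>j<k. \<integral>\<^sup>+t. F t * indicator (I j) t \<partial>lborel) / ennreal (2 * pi)"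
    by (simp add: divide_ennreal_def sum_distrib_left sum_distrib_right mult.assoc)
  also have "(\<Sum>j<k. \<integral>\<^sup>+t. F t * indicator (I j) t \<partial>lborel)
      = (\<integral>\<^sup>+t. (\<Sum>j<k. F t * indicator (I j) t) \<partial>lborel)"
    by (subst nn_integral_sum) (auto simp: I_def)
  also have "\<dots> = (\<integral>\<^sup>+t. F t * indicator {0..<2 * pi} t \<partial>lborel)"
  proof (intro nn_integral_cong)
    fix t :: real
    have Un: "(\<Union>j<k. I j) = {0..<2 * pi}"
    proof (intro equalityI subsetI)
      fix x assume "x \<in> (\<Union>j<k. I j)"
      then obtain j where j: "j < k" "x \<in> I j" by auto
      have "x < 2 * pi * real (Suc j) / real k" using j by (simp add: I_def)
      also have "\<dots> \<le> 2 * pi * real k / real k"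
        using j by (intro divide_right_mono mult_left_mono) auto
      also have "\<dots> = 2 * pi" using k by simp
      finally have "x < 2 * pi" .
      moreover have "0 \<le> 2 * pi * real j / real k" by simp
      with j(2) have "0 \<le> x" unfolding I_def by (meson atLeastLessThan_iff order_trans)
      ultimately show "x \<in> {0..<2 * pi}" by simp
    next
      fix x assume x: "x \<in> {0..<2 * pi}"
      define y where "y = x * real k / (2 * pi)"
      have y: "0 \<le> y" "y < real k" using x k by (auto simp: y_def field_simps)
      define j where "j = nat \<lfloor>y\<rfloor>"
      have jy: "real j \<le> y" "y < real (Suc j)" using y(1) unfolding j_def by linarith+
      have "j < k" using jy(1) y(2) by linarith
      moreover have "x \<in> I j" using jy k unfolding I_def y_def by (auto simp: field_simps)
      ultimately show "x \<in> (\<Union>j<k. I j)" by blast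
    qed
    have "disjoint_family_on I {..<k}"
    proof (unfold disjoint_family_on_def, safe)
      fix i j x assume ij: "i \<noteq> j" "x \<in> I i" "x \<in> I j"
      have "a = b" if "x \<in> I a" "x \<in> I b" for a b
      proof -
        define y where "y = x * real k / (2 * pi)"
        have "real a \<le> y" "y < real (Suc a)" "real b \<le> y" "y < real (Suc b)"
          using that k unfolding I_def y_def by (auto simp: field_simps)
        then show ?thesis by linarith
      qed
      with ij show "x \<in> {}" by blast
    qed
    then have "(\<Sum>j<k. indicator (I j) t) = (indicator (\<Union>j<k. I j) t :: ennreal)"
      by (subst indicator_UN_disjoint) auto
    then show "(\<Sum>j<k. F t * indicator (I j) t) = F t * indicator {0..<2 * pi} t"
      by (simp add: Un flip: sum_distrib_left)
  qed
  also have "of_nat k * \<dots> / ennreal (2 * pi) = of_nat k * (\<integral>\<^sup>+z. f z \<partial>circ)"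
    by (simp add: nn_integral_circ[OF f] F_def divide_ennreal_def mult.assoc)
  finally show ?thesis .
qed

lemma W_avg_L2:
  assumes k: "k \<ge> 1" and f: "f \<in> L2"
  shows "W_avg k f \<in> L2" and "L2norm (W_avg k f) \<le> L2norm f"
proof -
  have [measurable]: "f \<in> borel_measurable circ" and int: "integrable circ (\<lambda>z. (norm (f z))\<^sup>2)"
    using f by (auto simp: L2_def)
  have W [measurable]: "W_avg k f \<in> borel_measurable circ"
    unfolding W_avg_def[abs_def] by measurable
  have pt: "(norm (W_avg k f z))\<^sup>2 \<le> (\<Sum>j<k. (norm (f (kth_root k j z)))\<^sup>2) / real k" for z
  proof -
    have "(norm (W_avg k f z))\<^sup>2 \<le> ((\<Sum>j<k. norm (f (kth_root k j z))) / real k)\<^sup>2"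
      unfolding W_avg_def norm_divide norm_of_nat
      by (intro power_mono divide_right_mono norm_sum) auto
    also have "\<dots> \<le> (\<Sum>j<k. (norm (f (kth_root k j z)))\<^sup>2) * real k / (real k)\<^sup>2"
      unfolding power_divide
      using sum_squared_le_sum_of_squares[of "\<lambda>j. norm (f (kth_root k j z))" "{..<k}"]
      by (intro divide_right_mono) auto
    finally show ?thesis using k by (simp add: power2_eq_square)
  qed
  have "(\<integral>\<^sup>+z. ennreal ((norm (W_avg k f z))\<^sup>2) \<partial>circ)
      \<le> (\<integral>\<^sup>+z. (\<Sum>j<k. ennreal ((norm (f (kth_root k j z)))\<^sup>2)) * ennreal (1 / real k) \<partial>circ)"
    using pt by (intro nn_integral_mono) (auto simp: sum_nonneg simp flip: ennreal_mult intro!: ennreal_leI)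
  also have "\<dots> = (\<Sum>j<k. \<integral>\<^sup>+z. ennreal ((norm (f (kth_root k j z)))\<^sup>2) \<partial>circ) * ennreal (1 / real k)"
    by (simp add: nn_integral_multc nn_integral_sum del: sum_ennreal)
  also have "\<dots> = (of_nat k * ennreal (1 / real k)) * (\<integral>\<^sup>+z. ennreal ((norm (f z))\<^sup>2) \<partial>circ)"
    by (subst nn_integral_kth_roots[OF k, of "\<lambda>z. ennreal ((norm (f z))\<^sup>2)"]) (auto simp: ac_simps)
  also have "of_nat k * ennreal (1 / real k) = 1"
    using k by (simp add: ennreal_of_nat_eq_real_of_nat flip: ennreal_mult)
  finally have le: "(\<integral>\<^sup>+z. ennreal ((norm (W_avg k f z))\<^sup>2) \<partial>circ) \<le> (\<integral>\<^sup>+z. ennreal ((norm (f z))\<^sup>2) \<partial>circ)"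
    by simp
  also have "\<dots> < \<infinity>" using int by (simp add: integrable_iff_bounded)
  finally have fin: "(\<integral>\<^sup>+z. ennreal ((norm (W_avg k f z))\<^sup>2) \<partial>circ) < \<infinity>" .
  then show "W_avg k f \<in> L2" by (auto simp: L2_def integrable_iff_bounded)
  have "(\<integral>z. (norm (W_avg k f z))\<^sup>2 \<partial>circ) \<le> (\<integral>z. (norm (f z))\<^sup>2 \<partial>circ)"
    using le int by (simp add: integral_eq_nn_integral enn2real_mono integrable_iff_bounded)
  then show "L2norm (W_avg k f) \<le> L2norm f" by (simp add: L2norm_def)
qed

lemma W_avg_powi:
  assumes k: "k \<ge> 1" and z: "norm z = 1"
  shows "W_avg k (\<lambda>w. w powi n) z = (if int k dvd n then z powi (n div int k) else 0)"
proof -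
  define t where "t = Arg2pi z"
  define \<omega> where "\<omega> = cis (2 * pi * real_of_int n / real k)"
  have zt: "z = cis t" using z Arg2pi_eq[of z] by (simp add: t_def cis_conv_exp)
  have "kth_root k j z powi n = cis (real_of_int n * t / real k) * \<omega> ^ j" for j
    using k by (simp add: kth_root_def cis_power_int \<omega>_def Complex.DeMoivre cis_mult t_def field_simps)
  then have W: "W_avg k (\<lambda>w. w powi n) z = cis (real_of_int n * t / real k) * (\<Sum>j<k. \<omega> ^ j) / of_nat k"
    by (simp add: W_avg_def sum_distrib_left)
  show ?thesis
  proof (cases "int k dvd n")
    case True
    then obtain m where m: "n = int k * m" by auto
    have "2 * pi * real_of_int n / real k = 2 * pi * real_of_int m" using k by (simp add: m)
    then have "\<omega> = cis (2 * pi * real_of_int m)" by (simp only: \<omega>_def)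
    also have "\<dots> = 1" by (rule cis_multiple_2pi) simp
    finally have "W_avg k (\<lambda>w. w powi n) z = cis (real_of_int n * t / real k)"
      using k by (simp add: W)
    also have "real_of_int n * t / real k = real_of_int m * t" using k by (simp add: m)
    finally show ?thesis using True k by (simp add: m zt cis_power_int)
  next
    case False
    have "\<omega> ^ k = cis (2 * pi * real_of_int n)" using k by (simp add: \<omega>_def Complex.DeMoivre)
    also have "\<dots> = 1" by (rule cis_multiple_2pi) simp
    finally have "\<omega> ^ k = 1" .
    moreover have "\<omega> \<noteq> 1"
    proof
      assume "\<omega> = 1"
      then have "cos (2 * pi * real_of_int n / real k) = 1" by (simp add: \<omega>_def complex_eq_iff)
      then obtain m :: int where "2 * pi * real_of_int n / real k = real_of_int m * 2 * pi"
        by (auto simp: cos_one_2pi_int)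
      then have "real_of_int n = real_of_int (int k * m)" using k by (simp add: field_simps)
      then have "n = int k * m" by (simp only: of_int_eq_iff)
      with False show False by simp
    qed
    ultimately have "(\<Sum>j<k. \<omega> ^ j) = 0" by (simp add: geometric_sum)
    with False show ?thesis by (simp add: W)
  qed
qed

lemma is_W_W:
  assumes "k \<ge> 1"
  shows "is_W k (W k)"
proof -
  have "is_W k (W_avg k)"
    unfolding is_W_def bounded_L2_operator_def
  proof (intro conjI)
    show "\<forall>f\<in>L2. W_avg k f \<in> L2" using W_avg_L2[OF assms] by auto
    show "\<exists>C. \<forall>f\<in>L2. L2norm (W_avg k f) \<le> C * L2norm f"
      using W_avg_L2[OF assms] by (intro exI[of _ 1]) auto
    show "\<forall>f\<in>L2. \<forall>g\<in>L2. \<forall>a b. AE z in circ.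
        W_avg k (\<lambda>w. a * f w + b * g w) z = a * W_avg k f z + b * W_avg k g z"
      by (auto simp: W_avg_def sum.distrib sum_distrib_left add_divide_distrib)
    show "\<forall>n. AE z in circ. W_avg k (\<lambda>w. w powi n) z =
        (if int k dvd n then z powi (n div int k) else 0)"
      by (intro allI AE_I2 W_avg_powi[OF assms]) simp
  qed
  then show ?thesis unfolding W_def by (metis someI)
qed

end

theory Submission
  imports Defs "HOL-Complex_Analysis.Cauchy_Integral_Formula"
begin

text \<open>
  The adjoint of \<open>W\<^sub>k\<close> is \<open>h \<mapsto> h(z\<^sup>k)\<close>, so it suffices to show \<open>\<langle>\<phi> f, h(z\<^sup>k)\<rangle> = 0\<close> for \<open>f\<close> in \<open>K\<^sub>\<alpha>\<^sup>\<infinity>\<close>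
  and \<open>h\<close> in \<open>K\<^sub>\<beta>\<close>. For \<open>\<phi> = cnj (\<alpha> h\<^sub>1)\<close> the pairing is \<open>\<langle>f, \<alpha> h\<^sub>1 h(z\<^sup>k)\<rangle>\<close>, where \<open>h\<^sub>1 h(z\<^sup>k)\<close> is only
  in \<open>H\<^sup>1\<close>; since \<open>f\<close> is bounded, \<open>h\<^sub>1\<close> may be replaced by a monomial, and then \<open>f \<bottom> \<alpha> H\<^sup>2\<close> applies.
  For \<open>\<phi> = z\<^sup>1\<^sup>-\<^sup>k \<beta>(z\<^sup>k) h\<^sub>2\<close> one replaces in the same way first \<open>h\<^sub>2\<close> and then \<open>f\<close> by monomials. What remains
  is the integral of \<open>z\<^sup>j (\<beta> cnj h)(z\<^sup>k)\<close> with \<open>j > -k\<close>; it vanishes unless \<open>k\<close> divides \<open>j\<close>, and then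
  \<open>j \<ge> 0\<close> and it vanishes because \<open>h \<bottom> \<beta> H\<^sup>2\<close>.
\<close>

section \<open>The measure on the circle, \<open>L2\<close> and its inner product\<close>

lemma emeasure_circ_space: "emeasure circ (space circ) = 1"
proof -
  have "emeasure circ (space circ) = (\<integral>\<^sup>+z. 1 \<partial>circ)" by simp
  also have "\<dots> = (\<integral>\<^sup>+t. 1 * indicator {0..<2 * pi} t \<partial>lborel) / ennreal (2 * pi)"
    by (rule nn_integral_circ) simp
  also have "\<dots> = ennreal (2 * pi) / ennreal (2 * pi)" by simp
  also have "\<dots> = 1" by (intro ennreal_divide_self) (auto simp: pi_gt_zero)
  finally show ?thesis .
qed

interpretation circ: finite_measure circ
  by standard (simp add: emeasure_circ_space del: space_circ)

lemma continuous_on_measurable_circ: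
  "continuous_on (sphere 0 1) f \<Longrightarrow> f \<in> borel_measurable circ"
  by (subst measurable_cong_sets[OF sets_circ refl]) (rule borel_measurable_continuous_on_restrict)

lemma measurable_powi_circ [measurable]: "(\<lambda>z::complex. z powi n) \<in> borel_measurable circ"
  by (rule continuous_on_measurable_circ) (auto intro!: continuous_intros)

lemma measurable_cnj [measurable (raw)]:
  "f \<in> borel_measurable M \<Longrightarrow> (\<lambda>x. cnj (f x)) \<in> borel_measurable M"
  by (rule measurable_compose[OF _ borel_measurable_continuous_onI]) (auto intro!: continuous_intros)

lemma L2_measurable: "f \<in> L2 \<Longrightarrow> f \<in> borel_measurable circ"
  by (simp add: L2_def)

lemma L2_integrable: "f \<in> L2 \<Longrightarrow> integrable circ (\<lambda>z. (norm (f z))\<^sup>2)"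
  by (simp add: L2_def)

lemma L2_dominated:
  assumes "g \<in> L2" "f \<in> borel_measurable circ" "AE z in circ. norm (f z) \<le> B * norm (g z)"
  shows "f \<in> L2"
  unfolding L2_def
proof safe
  show "integrable circ (\<lambda>z. (norm (f z))\<^sup>2)"
  proof (rule Bochner_Integration.integrable_bound)
    show "integrable circ (\<lambda>z. B\<^sup>2 * (norm (g z))\<^sup>2)" using L2_integrable[OF assms(1)] by simp
    show "AE z in circ. norm ((norm (f z))\<^sup>2) \<le> norm (B\<^sup>2 * (norm (g z))\<^sup>2)"
      using assms(3)
    proof eventually_elim
      case (elim z)
      then have "(norm (f z))\<^sup>2 \<le> (B * norm (g z))\<^sup>2" by (rule power_mono) simp
      then show ?case by (simp add: power_mult_distrib)
    qed
  qed (use assms(2) in measurable)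
qed fact

lemma L2_const: "(\<lambda>z. c) \<in> L2"
  by (simp add: L2_def)

lemma L2_bounded:
  assumes "f \<in> borel_measurable circ" "AE z in circ. norm (f z) \<le> B"
  shows "f \<in> L2"
  by (rule L2_dominated[OF L2_const[of 1], where B = B]) (use assms in auto)

lemma L2_powi: "(\<lambda>z. z powi n) \<in> L2"
  by (rule L2_bounded[of _ 1]) (auto simp: norm_power_int)

lemma L2_cmult: "f \<in> L2 \<Longrightarrow> (\<lambda>z. c * f z) \<in> L2"
  by (rule L2_dominated[where B = "norm c"]) (auto simp: norm_mult dest: L2_measurable)

lemma L2_cnj: "f \<in> L2 \<Longrightarrow> (\<lambda>z. cnj (f z)) \<in> L2"
  by (rule L2_dominated[where B = 1]) (auto dest: L2_measurable)

lemma L2_mult_bounded: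
  assumes "f \<in> L2" "g \<in> borel_measurable circ" "AE z in circ. norm (g z) \<le> B"
  shows "(\<lambda>z. g z * f z) \<in> L2"
proof (rule L2_dominated[OF assms(1), where B = B])
  show "(\<lambda>z. g z * f z) \<in> borel_measurable circ" using assms L2_measurable by measurable
  show "AE z in circ. norm (g z * f z) \<le> B * norm (f z)"
    using assms(3) by eventually_elim (simp add: norm_mult mult_right_mono)
qed

lemma L2_mult_integrable:
  assumes "f \<in> L2" "g \<in> L2"
  shows "integrable circ (\<lambda>z. f z * g z)"
proof (rule Bochner_Integration.integrable_bound)
  show "integrable circ (\<lambda>z. (norm (f z))\<^sup>2 + (norm (g z))\<^sup>2)"
    using assms by (auto dest: L2_integrable)
  show "(\<lambda>z. f z * g z) \<in> borel_measurable circ" using assms[THEN L2_measurable] by measurable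
  have "a * b \<le> a\<^sup>2 + b\<^sup>2" if "a \<ge> 0" "b \<ge> 0" for a b :: real
    using sum_squares_bound[of a b] mult_nonneg_nonneg[OF that] by linarith
  then show "AE z in circ. norm (f z * g z) \<le> norm ((norm (f z))\<^sup>2 + (norm (g z))\<^sup>2)"
    by (auto simp: norm_mult)
qed

lemma ip_integrable: "f \<in> L2 \<Longrightarrow> g \<in> L2 \<Longrightarrow> integrable circ (\<lambda>z. f z * cnj (g z))"
  by (intro L2_mult_integrable L2_cnj)

lemma L2_add:
  assumes "f \<in> L2" "g \<in> L2"
  shows "(\<lambda>z. f z + g z) \<in> L2"
  unfolding L2_def
proof safe
  show [measurable]: "(\<lambda>z. f z + g z) \<in> borel_measurable circ"
    using assms[THEN L2_measurable] by measurable
  show "integrable circ (\<lambda>z. (norm (f z + g z))\<^sup>2)"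
  proof (rule Bochner_Integration.integrable_bound)
    show "integrable circ (\<lambda>z. 2 * (norm (f z))\<^sup>2 + 2 * (norm (g z))\<^sup>2)"
      using assms by (simp add: L2_integrable)
    have "(norm (f z + g z))\<^sup>2 \<le> 2 * (norm (f z))\<^sup>2 + 2 * (norm (g z))\<^sup>2" for z
    proof -
      have "(norm (f z + g z))\<^sup>2 \<le> (norm (f z) + norm (g z))\<^sup>2"
        by (intro power_mono norm_triangle_ineq) simp
      also have "\<dots> \<le> 2 * (norm (f z))\<^sup>2 + 2 * (norm (g z))\<^sup>2"
        using sum_squares_bound[of "norm (f z)" "norm (g z)"] by (simp add: power2_sum)
      finally show ?thesis .
    qed
    then show "AE z in circ. norm ((norm (f z + g z))\<^sup>2)
        \<le> norm (2 * (norm (f z))\<^sup>2 + 2 * (norm (g z))\<^sup>2)"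
      by auto
  qed measurable
qed

lemma L2_diff: "f \<in> L2 \<Longrightarrow> g \<in> L2 \<Longrightarrow> (\<lambda>z. f z - g z) \<in> L2"
  using L2_add[of f "\<lambda>z. -1 * g z"] L2_cmult[of g "-1"] by simp

lemma ip_add: "f \<in> L2 \<Longrightarrow> g \<in> L2 \<Longrightarrow> h \<in> L2 \<Longrightarrow> ip (\<lambda>z. f z + g z) h = ip f h + ip g h"
  unfolding ip_def by (simp add: ring_distribs ip_integrable)

lemma ip_diff: "f \<in> L2 \<Longrightarrow> g \<in> L2 \<Longrightarrow> h \<in> L2 \<Longrightarrow> ip (\<lambda>z. f z - g z) h = ip f h - ip g h"
  unfolding ip_def by (simp add: ring_distribs ip_integrable)

lemma ip_cmult: "ip (\<lambda>z. c * f z) h = c * ip f h"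
  unfolding ip_def by (simp add: mult.assoc)

lemma ip_cong_AE:
  assumes "f \<in> borel_measurable circ" "f' \<in> borel_measurable circ" "g \<in> borel_measurable circ"
    and "AE z in circ. f z = f' z"
  shows "ip f g = ip f' g"
  unfolding ip_def using assms by (intro integral_cong_AE) auto

lemma ip_self_eq_0:
  assumes "f \<in> L2" "ip f f = 0"
  shows "AE z in circ. f z = 0"
proof -
  have "ip f f = (\<integral>z. complex_of_real ((norm (f z))\<^sup>2) \<partial>circ)"
    unfolding ip_def by (simp only: complex_norm_square)
  also have "\<dots> = complex_of_real (\<integral>z. (norm (f z))\<^sup>2 \<partial>circ)" by (intro integral_of_real L2_integrable assms)
  finally have "(\<integral>z. (norm (f z))\<^sup>2 \<partial>circ) = 0" using assms(2) by simp
  then show ?thesis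
    using integral_nonneg_eq_0_iff_AE[OF L2_integrable[OF assms(1)]] by simp
qed

text \<open>\<open>Cauchy_Schwarz_nn_integral\<close>, applied to the moduli, bounds the integral
  \<open>c\<close> of their product, and \<open>c\<close> dominates the modulus of the inner
  product.\<close>

lemma Cauchy_Schwarz_ip:
  assumes "f \<in> L2" "g \<in> L2"
  shows "norm (ip f g) \<le> L2norm f * L2norm g"
proof -
  have [measurable]: "f \<in> borel_measurable circ" "g \<in> borel_measurable circ"
    using assms by (auto dest: L2_measurable)
  define c where "c = (\<integral>z. norm (f z) * norm (g z) \<partial>circ)"
  have int: "integrable circ (\<lambda>z. norm (f z) * norm (g z))"
    using integrable_norm[OF L2_mult_integrable[OF assms]] by (simp add: norm_mult)
  have nn: "(\<integral>\<^sup>+z. (ennreal (norm (u z)))\<^sup>2 \<partial>circ) = ennreal (\<integral>z. (norm (u z))\<^sup>2 \<partial>circ)"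
    if "u \<in> L2" for u
    using L2_integrable[OF that] by (simp add: ennreal_power nn_integral_eq_integral)
  have "(\<integral>\<^sup>+z. ennreal (norm (f z)) * ennreal (norm (g z)) \<partial>circ) = ennreal c"
    unfolding c_def using int by (simp add: nn_integral_eq_integral flip: ennreal_mult)
  then have "(ennreal c)\<^sup>2 \<le> ennreal ((\<integral>z. (norm (f z))\<^sup>2 \<partial>circ) * (\<integral>z. (norm (g z))\<^sup>2 \<partial>circ))"
    using Cauchy_Schwarz_nn_integral[of "\<lambda>z. ennreal (norm (f z))" circ "\<lambda>z. ennreal (norm (g z))"]
    by (simp add: nn assms ennreal_mult)
  moreover have "c \<ge> 0" by (simp add: c_def)
  ultimately have "c\<^sup>2 \<le> (\<integral>z. (norm (f z))\<^sup>2 \<partial>circ) * (\<integral>z. (norm (g z))\<^sup>2 \<partial>circ)"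
    by (subst (asm) ennreal_power) auto
  then have "c \<le> L2norm f * L2norm g"
    unfolding L2norm_def real_sqrt_mult[symmetric] by (rule real_le_rsqrt)
  moreover have "norm (ip f g) \<le> c"
    unfolding ip_def c_def using integral_norm_bound[of circ "\<lambda>z. f z * cnj (g z)"]
    by (simp add: norm_mult)
  ultimately show ?thesis by linarith
qed

section \<open>Weak convergence of bounded sequences that converge almost everywhere\<close>

text \<open>
  Splitting according to whether \<open>\<bar>s i - f\<bar> \<le> l * \<bar>q\<bar>\<close> makes the first part dominated and the second
  one \<open>O(1 / l)\<close>, so that neither Egorov's theorem nor norm convergence is needed.
\<close>

lemma bounded_AE_imp_weak_convergence:
  assumes s: "\<And>i. s i \<in> L2" and f: "f \<in> L2" and q: "q \<in> L2"
    and C: "\<And>i. (\<integral>z. (norm (s i z))\<^sup>2 \<partial>circ) \<le> C"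
    and lim: "AE z in circ. (\<lambda>i. s i z) \<longlonglongrightarrow> f z"
  shows "(\<lambda>i. ip (s i) q) \<longlonglongrightarrow> ip f q"
proof (rule LIMSEQ_I)
  fix e :: real assume e: "e > 0"
  have [measurable]: "s i \<in> borel_measurable circ" "f \<in> borel_measurable circ"
    "q \<in> borel_measurable circ" for i
    using assms by (auto dest: L2_measurable)
  define d where "d i z = norm (s i z - f z)" for i z
  have [measurable]: "d i \<in> borel_measurable circ" for i unfolding d_def by measurable
  have d2: "integrable circ (\<lambda>z. (d i z)\<^sup>2)" for i
    unfolding d_def by (intro L2_integrable L2_diff s f)
  \<comment> \<open>From |s - f|^2 <= 2 |s|^2 + 2 |f|^2; the bound is the same for every
    \<open>i\<close>.\<close>
  define D where "D = 2 * C + 2 * (\<integral>z. (norm (f z))\<^sup>2 \<partial>circ)"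
  have D: "(\<integral>z. (d i z)\<^sup>2 \<partial>circ) \<le> D" for i
  proof -
    have "(\<integral>z. (d i z)\<^sup>2 \<partial>circ) \<le> (\<integral>z. 2 * (norm (s i z))\<^sup>2 + 2 * (norm (f z))\<^sup>2 \<partial>circ)"
    proof (rule integral_mono)
      fix z
      have "(d i z)\<^sup>2 \<le> (norm (s i z) + norm (f z))\<^sup>2"
        unfolding d_def by (intro power_mono norm_triangle_ineq4) simp
      also have "\<dots> \<le> 2 * (norm (s i z))\<^sup>2 + 2 * (norm (f z))\<^sup>2"
        using sum_squares_bound[of "norm (s i z)" "norm (f z)"] by (simp add: power2_sum)
      finally show "(d i z)\<^sup>2 \<le> 2 * (norm (s i z))\<^sup>2 + 2 * (norm (f z))\<^sup>2" .
    qed (simp_all add: s f d2 L2_integrable)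
    also have "\<dots> = 2 * (\<integral>z. (norm (s i z))\<^sup>2 \<partial>circ) + 2 * (\<integral>z. (norm (f z))\<^sup>2 \<partial>circ)"
      using s f by (subst Bochner_Integration.integral_add) (auto dest: L2_integrable)
    finally show ?thesis using C[of i] by (simp add: D_def)
  qed
  have "0 \<le> (\<integral>z. (d 0 z)\<^sup>2 \<partial>circ)" by simp
  with D[of 0] have D0: "D \<ge> 0" by linarith
  \<comment> \<open>Chosen to make D / l < e / 2; the summand 1 keeps \<open>l\<close> positive when
    D = 0.\<close>
  define l where "l = 2 * (D + 1) / e"
  have l: "l > 0" "D / l < e / 2"
    using e D0 by (auto simp: l_def field_simps)
  \<comment> \<open>Cutting \<open>d\<close> off at \<open>l * norm (q z)\<close> gives the
    integrable majorant \<open>l * (norm (q z))^2\<close>, the same for every \<open>i\<close>, so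
    the integrals of \<open>m i\<close> tend to 0 by dominated convergence.\<close>
  define m where "m i z = min (d i z) (l * norm (q z)) * norm (q z)" for i z
  have [measurable]: "m i \<in> borel_measurable circ" for i unfolding m_def by measurable
  have m_dom: "\<bar>m i z\<bar> \<le> l * (norm (q z))\<^sup>2" for i z
  proof -
    have "m i z \<ge> 0" using l by (auto simp: m_def d_def)
    moreover have "m i z \<le> (l * norm (q z)) * norm (q z)"
      unfolding m_def by (intro mult_right_mono) auto
    ultimately show ?thesis by (simp add: power2_eq_square mult.assoc)
  qed
  have dom: "integrable circ (\<lambda>z. l * (norm (q z))\<^sup>2)" using L2_integrable[OF q] by simp
  have m_int: "integrable circ (m i)" for i
    by (rule Bochner_Integration.integrable_bound[OF dom])
       (auto intro!: order_trans[OF m_dom abs_ge_self] simp del: abs_mult)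
  have "(\<lambda>i. \<integral>z. m i z \<partial>circ) \<longlonglongrightarrow> (\<integral>z. 0 \<partial>circ)"
  proof (rule integral_dominated_convergence[OF _ _ dom])
    show "AE z in circ. (\<lambda>i. m i z) \<longlonglongrightarrow> 0"
      using lim
    proof eventually_elim
      case (elim z)
      then have "(\<lambda>i. d i z) \<longlonglongrightarrow> 0"
        unfolding d_def by (intro tendsto_norm_zero LIM_zero)
      then have "(\<lambda>i. m i z) \<longlonglongrightarrow> min 0 (l * norm (q z)) * norm (q z)"
        unfolding m_def by (intro tendsto_intros)
      then show ?case using l by simp
    qed
  qed (use m_dom in auto)
  then obtain N where N: "\<And>i. i \<ge> N \<Longrightarrow> (\<integral>z. m i z \<partial>circ) < e / 2"
    using LIMSEQ_D[of _ _ "e / 2"] e by (force simp: abs_less_iff)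
  have "norm (ip (s i) q - ip f q) < e" if "i \<ge> N" for i
  proof -
    have "norm (ip (s i) q - ip f q) = norm (ip (\<lambda>z. s i z - f z) q)"
      using s f q by (simp add: ip_diff)
    also have "\<dots> \<le> (\<integral>z. d i z * norm (q z) \<partial>circ)"
      unfolding ip_def d_def using integral_norm_bound[of circ "\<lambda>z. (s i z - f z) * cnj (q z)"]
      by (simp add: norm_mult)
    also have "\<dots> \<le> (\<integral>z. m i z + (d i z)\<^sup>2 / l \<partial>circ)"
    proof (rule integral_mono)
      show "integrable circ (\<lambda>z. d i z * norm (q z))"
        using integrable_norm[OF L2_mult_integrable[OF L2_diff[OF s f] q]] by (simp add: norm_mult d_def)
      show "integrable circ (\<lambda>z. m i z + (d i z)\<^sup>2 / l)" using m_int d2 by simp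
      \<comment> \<open>Where the cut-off acts, |q| < d / l, so the whole product is at most d^2 /
        l.\<close>
      show "d i z * norm (q z) \<le> m i z + (d i z)\<^sup>2 / l" for z
      proof (cases "d i z \<le> l * norm (q z)")
        case True
        then show ?thesis using l by (simp add: m_def)
      next
        case False
        then have "norm (q z) \<le> d i z / l" using l by (simp add: field_simps)
        then have "d i z * norm (q z) \<le> d i z * (d i z / l)"
          by (intro mult_left_mono) (auto simp: d_def)
        moreover have "m i z \<ge> 0" using l by (auto simp: m_def d_def)
        ultimately show ?thesis by (simp add: power2_eq_square)
      qed
    qed
    also have "\<dots> = (\<integral>z. m i z \<partial>circ) + (\<integral>z. (d i z)\<^sup>2 \<partial>circ) / l"
      using m_int d2 by simp
    also have "\<dots> < e / 2 + e / 2"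
      by (intro add_strict_mono N that le_less_trans[OF divide_right_mono[OF D] l(2)]) (use l in simp)
    finally show ?thesis by simp
  qed
  then show "\<exists>N. \<forall>i\<ge>N. norm (ip (s i) q - ip f q) < e" by blast
qed

section \<open>The map z -> z^k and averages over its fibres\<close>

lemma kth_root_power:
  assumes "k \<ge> 1" "norm z = 1"
  shows "kth_root k j z ^ k = z"
proof -
  have "kth_root k j z ^ k = cis (Arg2pi z + 2 * pi * real j)"
    using assms(1) by (simp add: kth_root_def Complex.DeMoivre)
  also have "\<dots> = cis (Arg2pi z) * cis (2 * pi * real_of_int (int j))" by (simp add: cis_mult del: cis_multiple_2pi)
  also have "cis (2 * pi * real_of_int (int j)) = 1" by (rule cis_multiple_2pi) simp
  finally show ?thesis using assms(2) Arg2pi_eq[of z] by (simp add: cis_conv_exp)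
qed

text \<open>One branch is bounded by the sum over all branches, and
  \<open>nn_integral_kth_roots\<close> evaluates that sum.\<close>

lemma integrable_kth_root:
  fixes q :: "complex \<Rightarrow> 'a::{banach, second_countable_topology}"
  assumes k: "k \<ge> 1" "j < k" and q: "integrable circ q"
  shows "integrable circ (\<lambda>z. q (kth_root k j z))"
  unfolding integrable_iff_bounded
proof
  have [measurable]: "q \<in> borel_measurable circ" using q by simp
  show "(\<lambda>z. q (kth_root k j z)) \<in> borel_measurable circ" by measurable
  have "(\<integral>\<^sup>+z. ennreal (norm (q (kth_root k j z))) \<partial>circ)
      \<le> (\<Sum>j<k. \<integral>\<^sup>+z. ennreal (norm (q (kth_root k j z))) \<partial>circ)"
    using k(2) by (intro member_le_sum) auto
  also have "\<dots> = of_nat k * (\<integral>\<^sup>+z. ennreal (norm (q z)) \<partial>circ)"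
    using k(1) by (intro nn_integral_kth_roots[of _ "\<lambda>z. ennreal (norm (q z))"]) auto
  also have "\<dots> < \<infinity>"
    using q by (auto simp: integrable_iff_bounded ennreal_mult_less_top of_nat_less_top)
  finally show "(\<integral>\<^sup>+z. ennreal (norm (q (kth_root k j z))) \<partial>circ) < \<infinity>" .
qed

text \<open>First of three stages that carry \<open>nn_integral_kth_roots\<close> over to Bochner
  integrals: nonnegative functions here, then real ones by positive and negative parts, then complex
  ones by real and imaginary parts.\<close>

lemma sum_integral_kth_roots_nonneg:
  fixes q :: "complex \<Rightarrow> real"
  assumes k: "k \<ge> 1" and q: "integrable circ q" and pos: "\<And>z. q z \<ge> 0"
  shows "(\<Sum>j<k. \<integral>z. q (kth_root k j z) \<partial>circ) = real k * (\<integral>z. q z \<partial>circ)"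
proof -
  have "ennreal (\<Sum>j<k. \<integral>z. q (kth_root k j z) \<partial>circ)
      = (\<Sum>j<k. ennreal (\<integral>z. q (kth_root k j z) \<partial>circ))"
    using pos by (intro sum_ennreal[symmetric]) auto
  also have "\<dots> = (\<Sum>j<k. \<integral>\<^sup>+z. ennreal (q (kth_root k j z)) \<partial>circ)"
    using k q pos by (intro sum.cong nn_integral_eq_integral[symmetric] integrable_kth_root) auto
  also have "\<dots> = of_nat k * (\<integral>\<^sup>+z. ennreal (q z) \<partial>circ)"
    using k q by (intro nn_integral_kth_roots[of _ "\<lambda>z. ennreal (q z)"]) auto
  also have "\<dots> = ennreal (real k * (\<integral>z. q z \<partial>circ))"
    using q pos by (simp add: nn_integral_eq_integral ennreal_mult ennreal_of_nat_eq_real_of_nat)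
  finally show ?thesis using pos by (subst (asm) ennreal_inj) (auto intro!: sum_nonneg)
qed

lemma sum_integral_kth_roots_real:
  fixes q :: "complex \<Rightarrow> real"
  assumes k: "k \<ge> 1" and q: "integrable circ q"
  shows "(\<Sum>j<k. \<integral>z. q (kth_root k j z) \<partial>circ) = real k * (\<integral>z. q z \<partial>circ)"
proof -
  define u v where "u z = max (q z) 0" and "v z = max (- q z) 0" for z
  have uv: "integrable circ u" "integrable circ v" and q_eq: "q = (\<lambda>z. u z - v z)"
    and pos: "u z \<ge> 0" "v z \<ge> 0" for z
    using q by (auto simp: u_def[abs_def] v_def[abs_def] fun_eq_iff)
  have "(\<Sum>j<k. \<integral>z. q (kth_root k j z) \<partial>circ)
      = (\<Sum>j<k. \<integral>z. u (kth_root k j z) \<partial>circ) - (\<Sum>j<k. \<integral>z. v (kth_root k j z) \<partial>circ)"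
    unfolding q_eq using k uv by (simp add: integrable_kth_root sum_subtractf)
  also have "\<dots> = real k * (\<integral>z. u z \<partial>circ) - real k * (\<integral>z. v z \<partial>circ)"
    using k uv pos by (simp add: sum_integral_kth_roots_nonneg)
  also have "\<dots> = real k * (\<integral>z. q z \<partial>circ)"
    unfolding q_eq using uv by (simp add: right_diff_distrib)
  finally show ?thesis .
qed

text \<open>Allows an integrand to be replaced by its average over the fibres of z -> z^k, on which
  functions of z^k are constant.\<close>

lemma integral_W_avg:
  assumes k: "k \<ge> 1" and q: "integrable circ q"
  shows "(\<integral>z. W_avg k q z \<partial>circ) = (\<integral>z. q z \<partial>circ)"
proof -
  have root: "integrable circ (\<lambda>z. q (kth_root k j z))" if "j < k" for j
    using k that q by (rule integrable_kth_root)
  have "(\<Sum>j<k. \<integral>z. q (kth_root k j z) \<partial>circ) = of_nat k * (\<integral>z. q z \<partial>circ)"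
  proof (rule complex_eqI)
    have "Re (\<Sum>j<k. \<integral>z. q (kth_root k j z) \<partial>circ) = (\<Sum>j<k. \<integral>z. Re (q (kth_root k j z)) \<partial>circ)"
      using root by simp
    also have "\<dots> = real k * (\<integral>z. Re (q z) \<partial>circ)"
      using k q by (intro sum_integral_kth_roots_real[of _ "\<lambda>z. Re (q z)"]) auto
    finally show "Re (\<Sum>j<k. \<integral>z. q (kth_root k j z) \<partial>circ) = Re (of_nat k * (\<integral>z. q z \<partial>circ))"
      using q by simp
    have "Im (\<Sum>j<k. \<integral>z. q (kth_root k j z) \<partial>circ) = (\<Sum>j<k. \<integral>z. Im (q (kth_root k j z)) \<partial>circ)"
      using root by simp
    also have "\<dots> = real k * (\<integral>z. Im (q z) \<partial>circ)"
      using k q by (intro sum_integral_kth_roots_real[of _ "\<lambda>z. Im (q z)"]) auto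
    finally show "Im (\<Sum>j<k. \<integral>z. q (kth_root k j z) \<partial>circ) = Im (of_nat k * (\<integral>z. q z \<partial>circ))"
      using q by simp
  qed
  then show ?thesis
    using k root by (simp add: W_avg_def Bochner_Integration.integral_sum)
qed

lemma measurable_power_circ [measurable]: "(\<lambda>z. z ^ k) \<in> circ \<rightarrow>\<^sub>M circ"
proof -
  have "(\<lambda>z::complex. z ^ k) \<in> circ \<rightarrow>\<^sub>M restrict_space borel (sphere 0 1)"
    by (intro measurable_restrict_space2 continuous_on_measurable_circ continuous_intros)
      (auto simp: norm_power)
  then show ?thesis by (simp cong: measurable_cong_sets)
qed

text \<open>For the indicator of the preimage of \<open>A\<close>, every branch in
  \<open>nn_integral_kth_roots\<close> contributes the measure of \<open>A\<close>, because the k-th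
  power of each root is z. This invariance lets almost-everywhere statements and integrals be pulled
  back along z -> z^k.\<close>

lemma distr_power_circ:
  assumes k: "k \<ge> 1"
  shows "distr circ circ (\<lambda>z. z ^ k) = circ"
proof (rule measure_eqI)
  fix A assume "A \<in> sets (distr circ circ (\<lambda>z. z ^ k))"
  then have A [measurable]: "A \<in> sets circ" by simp
  define x where "x = (\<integral>\<^sup>+z. indicator A (z ^ k) \<partial>circ)"
  have "of_nat k * x = (\<Sum>j<k. \<integral>\<^sup>+z. indicator A (kth_root k j z ^ k) \<partial>circ)"
    unfolding x_def by (rule nn_integral_kth_roots[OF k, symmetric]) measurable
  also have "\<dots> = (\<Sum>j<k. \<integral>\<^sup>+z. indicator A z \<partial>circ)"
    using k by (intro sum.cong nn_integral_cong refl) (simp add: kth_root_power)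
  also have "\<dots> = of_nat k * emeasure circ A" using A by simp
  finally have "x = emeasure circ A"
    using k by (subst (asm) ennreal_mult_cancel_left) auto
  moreover have "emeasure (distr circ circ (\<lambda>z. z ^ k)) A = x"
  proof -
    have "emeasure (distr circ circ (\<lambda>z. z ^ k)) A
        = (\<integral>\<^sup>+z. indicator A z \<partial>distr circ circ (\<lambda>z. z ^ k))" using A by simp
    also have "\<dots> = x" unfolding x_def by (rule nn_integral_distr) measurable
    finally show ?thesis .
  qed
  ultimately show "emeasure (distr circ circ (\<lambda>z. z ^ k)) A = emeasure circ A" by simp
qed simp

lemma AE_circ_power:
  assumes "k \<ge> 1" "AE z in circ. P z"
  shows "AE z in circ. P (z ^ k)"
proof (rule AE_distrD[where M' = circ])
  show "AE z in distr circ circ (\<lambda>z. z ^ k). P z" unfolding distr_power_circ[OF assms(1)] by (rule assms(2))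
qed measurable

lemma integrable_circ_power:
  fixes q :: "complex \<Rightarrow> 'a::{banach, second_countable_topology}"
  assumes "k \<ge> 1" "integrable circ q"
  shows "integrable circ (\<lambda>z. q (z ^ k))"
  by (rule integrable_distr[where M = circ and M' = circ]) (simp_all add: distr_power_circ[OF assms(1)] assms(2))

lemma integral_circ_power:
  fixes q :: "complex \<Rightarrow> 'a::{banach, second_countable_topology}"
  assumes "k \<ge> 1" "q \<in> borel_measurable circ"
  shows "(\<integral>z. q (z ^ k) \<partial>circ) = (\<integral>z. q z \<partial>circ)"
proof -
  have "(\<integral>z. q z \<partial>distr circ circ (\<lambda>z. z ^ k)) = (\<integral>z. q (z ^ k) \<partial>circ)"
    using assms(2) by (intro integral_distr) auto
  then show ?thesis by (simp add: distr_power_circ[OF assms(1)])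
qed

lemma L2_power:
  assumes "k \<ge> 1" "f \<in> L2"
  shows "(\<lambda>z. f (z ^ k)) \<in> L2"
  unfolding L2_def
proof safe
  have [measurable]: "f \<in> borel_measurable circ" by (rule L2_measurable) fact
  show "(\<lambda>z. f (z ^ k)) \<in> borel_measurable circ" by measurable
  show "integrable circ (\<lambda>z. (norm (f (z ^ k)))\<^sup>2)"
    by (rule integrable_circ_power[OF assms(1) L2_integrable[OF assms(2)]])
qed

text \<open>Averaging over the k-th roots leaves the factor q(z^k) alone, turning it into q(z), and
  acts on z^n by \<open>W_avg_powi\<close>. Used both for the adjoint of \<open>W\<close> and for
  the last integral of the proof.\<close>

lemma integral_powi_mult_power:
  assumes k: "k \<ge> 1" and q: "integrable circ q"
  shows "(\<integral>z. z powi n * q (z ^ k) \<partial>circ)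
    = (if int k dvd n then \<integral>z. z powi (n div int k) * q z \<partial>circ else 0)"
proof -
  have [measurable]: "q \<in> borel_measurable circ" using q by simp
  have "integrable circ (\<lambda>z. z powi n * q (z ^ k))"
    by (rule Bochner_Integration.integrable_bound[OF integrable_circ_power[OF k q]])
      (auto simp: norm_mult norm_power_int)
  then have "(\<integral>z. z powi n * q (z ^ k) \<partial>circ)
      = (\<integral>z. W_avg k (\<lambda>z. z powi n * q (z ^ k)) z \<partial>circ)"
    by (rule integral_W_avg[OF k, symmetric])
  also have "\<dots> = (\<integral>z. W_avg k (\<lambda>z. z powi n) z * q z \<partial>circ)"
    using k by (intro Bochner_Integration.integral_cong refl)
      (simp add: W_avg_def kth_root_power sum_distrib_right)
  also have "\<dots> = (\<integral>z. (if int k dvd n then z powi (n div int k) else 0) * q z \<partial>circ)"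
    using k by (intro Bochner_Integration.integral_cong refl) (simp add: W_avg_powi)
  finally show ?thesis by simp
qed

section \<open>Density of the trigonometric polynomials in \<open>L2\<close>\<close>

text \<open>The limit inherits the majorant, so \<open>2 * norm (w z)\<close> dominates the
  differences and dominated convergence applies to their squares.\<close>

lemma L2_dominated_convergence:
  assumes s: "\<And>i. s i \<in> L2" and w: "w \<in> L2" and f: "f \<in> borel_measurable circ"
    and bound: "\<And>i z. norm z = 1 \<Longrightarrow> norm (s i z) \<le> norm (w z)"
    and lim: "\<And>z. norm z = 1 \<Longrightarrow> (\<lambda>i. s i z) \<longlonglongrightarrow> f z"
  shows "f \<in> L2" and "(\<lambda>i. L2norm (\<lambda>z. s i z - f z)) \<longlonglongrightarrow> 0"
proof -
  have [measurable]: "s i \<in> borel_measurable circ" "f \<in> borel_measurable circ" for i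
    using s f by (auto dest: L2_measurable)
  have fw: "norm (f z) \<le> norm (w z)" if "norm z = 1" for z
    by (rule tendsto_upperbound[OF tendsto_norm[OF lim[OF that]]]) (auto simp: bound that)
  then show "f \<in> L2" by (intro L2_dominated[OF w f, of 1]) auto
  have "(\<lambda>i. \<integral>z. (norm (s i z - f z))\<^sup>2 \<partial>circ) \<longlonglongrightarrow> (\<integral>z. 0 \<partial>circ)"
  proof (rule integral_dominated_convergence)
    show "integrable circ (\<lambda>z. (2 * norm (w z))\<^sup>2)"
      using L2_integrable[OF w] by (simp add: power_mult_distrib)
    show "AE z in circ. (\<lambda>i. (norm (s i z - f z))\<^sup>2) \<longlonglongrightarrow> 0"
    proof (rule AE_I2)
      fix z assume "z \<in> space circ"
      then have "(\<lambda>i. (norm (s i z - f z))\<^sup>2) \<longlonglongrightarrow> (norm (f z - f z))\<^sup>2"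
        by (intro tendsto_intros lim) simp
      then show "(\<lambda>i. (norm (s i z - f z))\<^sup>2) \<longlonglongrightarrow> 0" by simp
    qed
    show "AE z in circ. norm ((norm (s i z - f z))\<^sup>2) \<le> (2 * norm (w z))\<^sup>2" for i
    proof (rule AE_I2)
      fix z assume z: "z \<in> space circ"
      have "norm (s i z - f z) \<le> 2 * norm (w z)"
        using bound[of z i] fw[of z] norm_triangle_ineq4[of "s i z" "f z"] z by simp
      then show "norm ((norm (s i z - f z))\<^sup>2) \<le> (2 * norm (w z))\<^sup>2"
        using power_mono[of "norm (s i z - f z)" "2 * norm (w z)" 2] by simp
    qed
  qed (use f in measurable)
  then show "(\<lambda>i. L2norm (\<lambda>z. s i z - f z)) \<longlonglongrightarrow> 0"
    unfolding L2norm_def using tendsto_real_sqrt[of _ 0] by simp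
qed

lemma L2_continuous_on:
  assumes "continuous_on (sphere 0 1) g"
  shows "g \<in> L2"
proof -
  have "bounded (g ` sphere 0 1)"
    using assms by (intro compact_imp_bounded compact_continuous_image) auto
  then obtain B where "\<And>z. norm z = 1 \<Longrightarrow> norm (g z) \<le> B"
    unfolding bounded_iff by (metis imageI mem_sphere_0)
  then show ?thesis
    using assms by (intro L2_bounded[of _ B] continuous_on_measurable_circ) auto
qed

text \<open>Density of the span of the monomials, cast as an induction rule. The closure reaches in
  turn real polynomials in the coordinates, continuous functions by Stone-Weierstrass, indicators of
  open sets, indicators of Borel sets, simple functions, and all of \<open>L2\<close>.\<close>

lemma L2_powi_induct [consumes 1, case_names powi linear limit]:
  assumes f: "f \<in> L2"
    and powi: "\<And>n. P (\<lambda>z. z powi n)"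
    and linear: "\<And>f g a b. f \<in> L2 \<Longrightarrow> g \<in> L2 \<Longrightarrow> P f \<Longrightarrow> P g \<Longrightarrow> P (\<lambda>z. a * f z + b * g z)"
    and limit: "\<And>s f. (\<And>i::nat. s i \<in> L2) \<Longrightarrow> (\<And>i. P (s i)) \<Longrightarrow> f \<in> L2 \<Longrightarrow>
      (\<lambda>i. L2norm (\<lambda>z. s i z - f z)) \<longlonglongrightarrow> 0 \<Longrightarrow> P f"
  shows "P f"
proof -
  \<comment> \<open>The form in which \<open>limit\<close> gets used: pointwise convergence on the
    circle under an \<open>L2\<close> majorant.\<close>
  have dom: "P f" if "\<And>i::nat. s i \<in> L2" "\<And>i. P (s i)" "w \<in> L2"
      "\<And>i z. norm z = 1 \<Longrightarrow> norm (s i z) \<le> norm (w z)"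
      "f \<in> borel_measurable circ" "\<And>z. norm z = 1 \<Longrightarrow> (\<lambda>i. s i z) \<longlonglongrightarrow> f z" for s f w
    by (rule limit[OF that(1,2) L2_dominated_convergence[OF that(1,3,5,4,6)]])
  \<comment> \<open>\<open>P\<close> speaks of functions on the whole plane; a constant sequence in
    \<open>dom\<close> shows that it ignores values off the circle.\<close>
  have cong: "P g" if "P f" "f \<in> L2" "\<And>z. norm z = 1 \<Longrightarrow> f z = g z" for f g
  proof (rule dom[of "\<lambda>_. f" f])
    have "f \<in> borel_measurable circ \<longleftrightarrow> g \<in> borel_measurable circ"
      using that(3) by (intro measurable_cong) auto
    then show "g \<in> borel_measurable circ" using L2_measurable[OF that(2)] by simp
  qed (use that in auto)
  \<comment> \<open>Stated for multipliers of an arbitrary \<open>g\<close>, because \<open>P\<close> need not be closed under products.\<close>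
  have poly_step: "\<forall>g. continuous_on (sphere 0 1) g \<longrightarrow> (\<forall>n::int. P (\<lambda>z. z powi n * g z)) \<longrightarrow>
      (\<forall>n::int. P (\<lambda>z. z powi n * (complex_of_real (p z) * g z)))"
    if "real_polynomial_function p" for p
    using that
  proof (induction rule: real_polynomial_function.induct)
    case (linear p)
    show ?case
    proof safe
      fix g :: "complex \<Rightarrow> complex" and n :: int
      assume g: "continuous_on (sphere 0 1) g" "\<forall>n::int. P (\<lambda>z. z powi n * g z)"
      \<comment> \<open>A real-linear \<open>p\<close> satisfies p(z) = Re z p(1) + Im z p(i) = c z
        + cnj (c z) with this \<open>c\<close>. Since cnj z = 1/z on the circle, multiplying by
        \<open>p\<close> only shifts the exponent \<open>n\<close> by 1 in both directions.\<close>
      define c where "c = Complex (p 1 / 2) (- p \<i> / 2)"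
      have L2: "(\<lambda>z. z powi n * g z) \<in> L2" for n
        using g by (intro L2_continuous_on continuous_intros) auto
      have p: "complex_of_real (p z) = c * z + cnj c * cnj z" for z
      proof -
        have "p z = p (Re z *\<^sub>R 1 + Im z *\<^sub>R \<i>)"
          by (rule arg_cong[of _ _ p]) (simp add: complex_eq_iff)
        also have "\<dots> = Re z * p 1 + Im z * p \<i>"
          using linear by (simp add: linear_simps)
        finally show ?thesis by (simp add: c_def complex_eq_iff field_simps)
      qed
      show "P (\<lambda>z. z powi n * (complex_of_real (p z) * g z))"
      proof (rule cong)
        show "P (\<lambda>z. c * (z powi (n + 1) * g z) + cnj c * (z powi (n - 1) * g z))"
          using g L2 by (intro assms(3)) auto
        show "(\<lambda>z. c * (z powi (n + 1) * g z) + cnj c * (z powi (n - 1) * g z)) \<in> L2"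
          by (intro L2_add L2_cmult L2)
        fix z :: complex assume z: "norm z = 1"
        then have "z \<noteq> 0" "z * cnj z = 1" by (auto simp flip: complex_norm_square)
        then have "z \<noteq> 0" "cnj z = 1 / z" by (auto simp: eq_divide_eq mult.commute)
        then show "c * (z powi (n + 1) * g z) + cnj c * (z powi (n - 1) * g z)
            = z powi n * (complex_of_real (p z) * g z)"
          by (simp add: p power_int_add power_int_diff field_simps)
      qed
    qed
  next
    case (const c)
    show ?case
    proof safe
      fix g :: "complex \<Rightarrow> complex" and n :: int
      assume g: "continuous_on (sphere 0 1) g" "\<forall>n::int. P (\<lambda>z. z powi n * g z)"
      have L2: "(\<lambda>z. z powi n * g z) \<in> L2"
        using g by (intro L2_continuous_on continuous_intros) auto
      have "P (\<lambda>z. of_real c * (z powi n * g z) + 0 * (z powi n * g z))"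
        using g L2 by (intro assms(3)) auto
      then show "P (\<lambda>z. z powi n * (complex_of_real c * g z))"
        by (simp add: mult.left_commute)
    qed
  next
    case (add p q)
    show ?case
    proof safe
      fix g :: "complex \<Rightarrow> complex" and n :: int
      assume g: "continuous_on (sphere 0 1) g" "\<forall>n::int. P (\<lambda>z. z powi n * g z)"
      have L2: "(\<lambda>z. z powi n * (complex_of_real (r z) * g z)) \<in> L2"
        if "real_polynomial_function r" for r
        using g continuous_on_polymonial_function[of r "sphere 0 1"] that
        by (intro L2_continuous_on continuous_intros) (auto simp: real_polynomial_function_eq)
      have "P (\<lambda>z. 1 * (z powi n * (complex_of_real (p z) * g z)) + 1 * (z powi n * (complex_of_real (q z) * g z)))"
        using g add L2 by (intro assms(3)) auto
      then show "P (\<lambda>z. z powi n * (complex_of_real (p z + q z) * g z))"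
        by (simp add: algebra_simps)
    qed
  next
    case (mult p q)
    show ?case
    proof safe
      fix g :: "complex \<Rightarrow> complex" and n :: int
      assume g: "continuous_on (sphere 0 1) g" "\<forall>n::int. P (\<lambda>z. z powi n * g z)"
      have "continuous_on (sphere 0 1) (\<lambda>z. complex_of_real (q z) * g z)"
        using g mult continuous_on_polymonial_function[of q "sphere 0 1"]
        by (intro continuous_intros) (auto simp: real_polynomial_function_eq)
      then have "P (\<lambda>z. z powi n * (complex_of_real (p z) * (complex_of_real (q z) * g z)))"
        using g mult.IH by blast
      then show "P (\<lambda>z. z powi n * (complex_of_real (p z * q z) * g z))"
        by (simp add: mult.assoc)
    qed
  qed
  have one: "P (\<lambda>z. 1)" using powi[of 0] by simp
  have poly: "P (\<lambda>z. complex_of_real (p z))" if "real_polynomial_function p" for p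
    using poly_step[OF that, rule_format, of "\<lambda>_. 1" 0] powi by simp
  have cont: "P (\<lambda>z. complex_of_real (h z))" if h: "continuous_on (sphere 0 1) h" for h
  proof -
    have "\<exists>p. real_polynomial_function p \<and> (\<forall>z\<in>sphere 0 1. \<bar>h z - p z\<bar> < 1 / real (Suc i))" for i
      using Stone_Weierstrass_real_polynomial_function[of "sphere 0 1" h "1 / real (Suc i)"] h
      by (metis compact_sphere of_nat_0_less_iff zero_less_Suc zero_less_divide_1_iff)
    then obtain p where p: "\<And>i. real_polynomial_function (p i)"
        "\<And>i z. norm z = 1 \<Longrightarrow> \<bar>h z - p i z\<bar> < 1 / real (Suc i)"
      by (metis mem_sphere_0)
    have hc: "continuous_on (sphere 0 1) (\<lambda>z. complex_of_real (h z))"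
      using h by (intro continuous_intros)
    show ?thesis
    \<comment> \<open>All approximation errors are at most 1, which explains the majorant |h| +
      1.\<close>
    proof (rule dom[of "\<lambda>i z. complex_of_real (p i z)" "\<lambda>z. complex_of_real (\<bar>h z\<bar> + 1)"])
      show "(\<lambda>z. complex_of_real (p i z)) \<in> L2" for i
        using p(1)[of i] continuous_on_polymonial_function[of "p i" "sphere 0 1"]
        by (intro L2_continuous_on continuous_intros) (auto simp: real_polynomial_function_eq)
      show "P (\<lambda>z. complex_of_real (p i z))" for i using p poly by blast
      show "(\<lambda>z. complex_of_real (\<bar>h z\<bar> + 1)) \<in> L2"
        using h by (intro L2_continuous_on continuous_intros)
      show "(\<lambda>z. complex_of_real (h z)) \<in> borel_measurable circ"
        using hc by (rule continuous_on_measurable_circ)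
      fix z :: complex assume z: "norm z = 1"
      show "norm (complex_of_real (p i z)) \<le> norm (complex_of_real (\<bar>h z\<bar> + 1))" for i
      proof -
        have "1 / real (Suc i) \<le> 1" by simp
        then have "\<bar>p i z\<bar> \<le> \<bar>h z\<bar> + 1" using p(2)[OF z, of i] by linarith
        then show ?thesis unfolding norm_of_real by simp
      qed
      have "(\<lambda>i. p i z - h z) \<longlonglongrightarrow> 0"
        by (rule Lim_null_comparison[OF _ LIMSEQ_inverse_real_of_nat])
          (use p(2)[OF z] in \<open>auto intro!: always_eventually less_imp_le simp: abs_minus_commute inverse_eq_divide\<close>)
      then show "(\<lambda>i. complex_of_real (p i z)) \<longlonglongrightarrow> complex_of_real (h z)"
        by (intro tendsto_of_real) (simp add: LIM_zero_iff)
    qed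
  qed
  have ind_meas [measurable]: "(indicator A :: complex \<Rightarrow> complex) \<in> borel_measurable circ"
    if "A \<in> sets borel" for A
    by (subst measurable_cong_sets[OF sets_circ refl])
      (use that in \<open>auto intro!: measurable_restrict_space1\<close>)
  have ind_L2: "(indicator A :: complex \<Rightarrow> complex) \<in> L2" if "A \<in> sets borel" for A
    using that by (intro L2_bounded[of _ 1]) (auto simp: indicator_def)
  \<comment> \<open>The indicator is the limit of the cut-off multiples min(1, i dist(z, -A)). The
    case \<open>A = UNIV\<close> is separate because \<open>infdist\<close> to the empty set is 0 by
    convention, which would make these functions vanish.\<close>
  have ind_open: "P (indicator A)" if A: "open A" for A
  proof (cases "A = UNIV")
    case True
    then show ?thesis using one by (simp add: indicator_def[abs_def])
  next
    case False
    define h where "h i z = min 1 (real i * infdist z (- A))" for i z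
    have hc: "continuous_on S (\<lambda>z. complex_of_real (h i z))" for i S
      unfolding h_def by (intro continuous_intros)
    show ?thesis
    proof (rule dom[of "\<lambda>i z. complex_of_real (h i z)" "\<lambda>_. 1"])
      show "P (\<lambda>z. complex_of_real (h i z))" for i
        by (rule cont) (unfold h_def, intro continuous_intros)
      show "(indicator A :: complex \<Rightarrow> complex) \<in> borel_measurable circ" using A by simp
      show "norm (complex_of_real (h i z)) \<le> norm (1::complex)" for i z
        unfolding norm_of_real h_def by (simp add: infdist_nonneg)
      fix z :: complex
      show "(\<lambda>i. complex_of_real (h i z)) \<longlonglongrightarrow> indicator A z"
      proof (cases "z \<in> A")
        case True
        then have "infdist z (- A) \<noteq> 0"
          using in_closed_iff_infdist_zero[of "- A" z] A False by auto
        then have d: "infdist z (- A) > 0" using infdist_nonneg[of z "- A"] by linarith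
        obtain N where N: "1 / infdist z (- A) < real N" using reals_Archimedean2 by blast
        have "h i z = 1" if "i \<ge> N" for i
        proof -
          have "1 / infdist z (- A) \<le> real i" using N that by linarith
          then have "1 \<le> real i * infdist z (- A)" using d by (simp add: field_simps)
          then show ?thesis by (simp add: h_def)
        qed
        then have "\<forall>\<^sub>F i in sequentially. complex_of_real (h i z) = indicator A z"
          using True by (intro eventually_sequentiallyI[of N]) simp
        then show ?thesis by (rule tendsto_eventually)
      next
        case False
        then show ?thesis by (simp add: h_def)
      qed
    qed (use hc in \<open>auto intro!: L2_continuous_on L2_const\<close>)
  qed
  \<comment> \<open>Open sets form an intersection-stable generator, so Dynkin's argument leaves
    complements, handled by linearity, and disjoint unions, handled as dominated limits of finite
    unions.\<close>
  have ind: "P (indicator A)" if "A \<in> sets borel" for A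
  proof -
    have "Int_stable {S::complex set. open S}" "{S::complex set. open S} \<subseteq> Pow UNIV"
      "A \<in> sigma_sets UNIV {S. open S}"
      using that by (auto simp: Int_stable_def borel_def)
    then show ?thesis
    proof (induction rule: sigma_sets_induct_disjoint)
      case (basic A)
      then show ?case using ind_open by simp
    next
      case empty
      show ?case by (rule ind_open) simp
    next
      case (compl A)
      then have "A \<in> sets borel" by (simp add: borel_def)
      then have "P (\<lambda>z. 1 * 1 + (-1) * indicator A z)"
        using compl one L2_const[of 1] ind_L2 by (intro linear) auto
      moreover have "(\<lambda>z. 1 * 1 + (-1) * indicator A z) = (indicator (UNIV - A) :: complex \<Rightarrow> complex)"
        by (auto simp: fun_eq_iff indicator_def)
      ultimately show ?case by simp
    next
      case (union A)
      have A: "A i \<in> sets borel" for i using union(2) by (auto simp: borel_def)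
      have fin: "P (indicator (\<Union>i<n. A i))" for n
      proof (induction n)
        case 0
        show ?case by (rule ind_open) simp
      next
        case (Suc n)
        have "P (\<lambda>z. 1 * indicator (\<Union>i<n. A i) z + 1 * indicator (A n) z)"
          using A union(3) Suc by (intro linear ind_L2) auto
        moreover have "A n \<inter> (\<Union>i<n. A i) = {}"
          using union(1) by (auto simp: disjoint_family_on_def) (metis IntI empty_iff less_irrefl)
        then have "(\<lambda>z. 1 * indicator (\<Union>i<n. A i) z + 1 * indicator (A n) z)
            = (indicator (\<Union>i<Suc n. A i) :: complex \<Rightarrow> complex)"
          by (auto simp: fun_eq_iff indicator_def lessThan_Suc)
        ultimately show ?case by simp
      qed
      show ?case
      proof (rule dom[of "\<lambda>n. indicator (\<Union>i<n. A i)" "\<lambda>_. 1"])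
        show "(\<lambda>n. indicator (\<Union>i<n. A i) z) \<longlonglongrightarrow> (indicator (\<Union>i. A i) z :: complex)" for z
          by (rule LIMSEQ_indicator_UN)
        show "(indicator (\<Union>i. A i) :: complex \<Rightarrow> complex) \<in> borel_measurable circ"
          using A by (intro ind_meas) auto
        show "(indicator (\<Union>i<n. A i) :: complex \<Rightarrow> complex) \<in> L2" for n
          using A by (intro ind_L2) auto
      qed (use fin in \<open>auto intro!: L2_const simp: indicator_def\<close>)
    qed
  qed
  have simple: "P g" if g: "simple_function circ g" for g
  proof -
    \<comment> \<open>The measurable sets of \<open>circ\<close> are traces of Borel sets of the
      plane, so each level set can be exchanged for a Borel set \<open>A y\<close> to which
      \<open>ind\<close> applies.\<close>
    have *: "\<exists>A\<in>sets borel. g -` {y} \<inter> space circ = A \<inter> sphere 0 1" for y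
    proof -
      have "g -` {y} \<inter> space circ \<in> sets (restrict_space borel (sphere 0 1))"
        using simple_functionD(2)[OF g, of "{y}"] by simp
      then show ?thesis by (auto simp: sets_restrict_space)
    qed
    then obtain A where A: "\<And>y. A y \<in> sets borel" "\<And>y. g -` {y} \<inter> space circ = A y \<inter> sphere 0 1"
      by metis
    have sums: "P (\<lambda>z. \<Sum>y\<in>Y. y * indicator (A y) z) \<and> (\<lambda>z. \<Sum>y\<in>Y. y * indicator (A y) z) \<in> L2"
      if "finite Y" for Y
      using that
    proof induction
      case empty
      show ?case using linear[OF L2_powi L2_powi powi powi, of 0 0 0 0] L2_const by simp
    next
      case (insert y Y)
      have "P (\<lambda>z. y * indicator (A y) z + 1 * (\<Sum>y\<in>Y. y * indicator (A y) z))"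
        using insert A ind by (intro linear ind_L2) auto
      moreover have "(\<lambda>z. y * indicator (A y) z + (\<Sum>y\<in>Y. y * indicator (A y) z)) \<in> L2"
        using insert A by (intro L2_add L2_cmult ind_L2) auto
      ultimately show ?case
        unfolding sum.insert[OF insert(1,2)] mult_1_left by (rule conjI)
    qed
    show ?thesis
    proof (rule cong)
      show "P (\<lambda>z. \<Sum>y\<in>g ` space circ. y * indicator (A y) z)"
        "(\<lambda>z. \<Sum>y\<in>g ` space circ. y * indicator (A y) z) \<in> L2"
        using sums simple_functionD(1)[OF g] by blast+
      fix z :: complex assume z: "norm z = 1"
      have "g z = (\<Sum>y\<in>g ` space circ. indicator (g -` {y} \<inter> space circ) z *\<^sub>R y)"
        using z by (intro simple_function_indicator_representation_banach g) simp
      also have "\<dots> = (\<Sum>y\<in>g ` space circ. y * indicator (A y) z)"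
        using z unfolding A(2) by (intro sum.cong) (auto simp: indicator_def)
      finally show "(\<Sum>y\<in>g ` space circ. y * indicator (A y) z) = g z" ..
    qed
  qed
  \<comment> \<open>Approximation relative to the base point 0 gives |s i| <= 2 |f|, hence the
    majorant 2 f in \<open>L2\<close>.\<close>
  obtain s where s: "\<And>i. simple_function circ (s i)"
      "\<And>z. z \<in> space circ \<Longrightarrow> (\<lambda>i. s i z) \<longlonglongrightarrow> f z"
      "\<And>i z. z \<in> space circ \<Longrightarrow> norm (s i z) \<le> 2 * norm (f z)"
    using borel_measurable_implies_sequence_metric[OF L2_measurable[OF f], of 0]
    unfolding dist_norm diff_zero by blast
  have s_L2: "s i \<in> L2" for i
    using s by (intro L2_dominated[OF f, of _ 2] borel_measurable_simple_function) auto
  show "P f"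
  proof (rule dom[of s "\<lambda>z. 2 * f z"])
    show "(\<lambda>z. 2 * f z) \<in> L2" by (intro L2_cmult f)
  qed (use s s_L2 simple f in \<open>auto simp: norm_mult L2_measurable\<close>)
qed

section \<open>The adjoint of \<open>W k\<close>\<close>

lemma tendsto_ip:
  assumes "\<And>i::nat. s i \<in> L2" "f \<in> L2" "q \<in> L2"
    and lim: "(\<lambda>i. L2norm (\<lambda>z. s i z - f z)) \<longlonglongrightarrow> 0"
  shows "(\<lambda>i. ip (s i) q) \<longlonglongrightarrow> ip f q"
proof -
  have "(\<lambda>i. ip (s i) q - ip f q) \<longlonglongrightarrow> 0"
  proof (rule Lim_null_comparison)
    show "\<forall>\<^sub>F i in sequentially. norm (ip (s i) q - ip f q) \<le> L2norm (\<lambda>z. s i z - f z) * L2norm q"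
      using Cauchy_Schwarz_ip[OF L2_diff[OF assms(1,2)] assms(3)] assms(1-3)
      by (simp add: ip_diff)
    show "(\<lambda>i. L2norm (\<lambda>z. s i z - f z) * L2norm q) \<longlonglongrightarrow> 0"
      using tendsto_mult_right[OF lim, of "L2norm q"] by simp
  qed
  then show ?thesis by (simp add: LIM_zero_iff)
qed

text \<open>Both sides are linear and \<open>L2\<close>-continuous in \<open>g\<close>, so monomials
  suffice, where \<open>integral_powi_mult_power\<close> gives the identity. It is proved for every
  \<open>T\<close> with \<open>is_W k T\<close>, since \<open>W k\<close> is a choice known only
  through that property.\<close>

lemma is_W_adjoint:
  assumes k: "k \<ge> 1" and T: "is_W k T" and g: "g \<in> L2" and h: "h \<in> L2"
  shows "ip (T g) h = ip g (\<lambda>z. h (z ^ k))"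
  using g
proof (induction g rule: L2_powi_induct)
  have T_L2: "T f \<in> L2" if "f \<in> L2" for f
    using T that by (auto simp: is_W_def bounded_L2_operator_def)
  have T_lin: "AE z in circ. T (\<lambda>w. a * f w + b * g w) z = a * T f z + b * T g z"
    if "f \<in> L2" "g \<in> L2" for f g a b
    using T that by (auto simp: is_W_def bounded_L2_operator_def)
  have hk: "(\<lambda>z. h (z ^ k)) \<in> L2" using k h by (rule L2_power)
  have lin: "ip (T (\<lambda>w. a * f w + b * g w)) h = a * ip (T f) h + b * ip (T g) h"
    if "f \<in> L2" "g \<in> L2" for f g a b
  proof -
    have "ip (T (\<lambda>w. a * f w + b * g w)) h = ip (\<lambda>z. a * T f z + b * T g z) h"
      using that by (intro ip_cong_AE L2_measurable T_L2 L2_add L2_cmult h T_lin)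
    then show ?thesis
      using that by (simp add: ip_add ip_cmult L2_cmult T_L2 h)
  qed
  {
    case (powi n)
    have [measurable]: "h \<in> borel_measurable circ" using h by (rule L2_measurable)
    have "(\<lambda>z. if int k dvd n then z powi (n div int k) else 0) \<in> L2"
      by (cases "int k dvd n") (simp_all add: L2_powi L2_const)
    then have "ip (T (\<lambda>z. z powi n)) h = ip (\<lambda>z. if int k dvd n then z powi (n div int k) else 0) h"
      using T by (intro ip_cong_AE L2_measurable T_L2 L2_powi h)
        (auto simp: is_W_def)
    also have "\<dots> = (\<integral>z. z powi n * cnj (h (z ^ k)) \<partial>circ)"
      using integral_powi_mult_power[OF k, of "\<lambda>z. cnj (h z)" n]
        L2_mult_integrable[OF L2_const[of 1] L2_cnj[OF h]] by (simp add: ip_def)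
    finally show ?case by (simp add: ip_def)
  next
    case (linear f g a b)
    then show ?case by (simp add: lin ip_add ip_cmult L2_cmult hk)
  next
    case (limit s f)
    \<comment> \<open>Boundedness, together with Cauchy-Schwarz, makes the left side continuous in
      \<open>g\<close>; \<open>tendsto_ip\<close> does this for the right side.\<close>
    obtain C where C: "\<And>f. f \<in> L2 \<Longrightarrow> L2norm (T f) \<le> C * L2norm f"
      using T unfolding is_W_def bounded_L2_operator_def by blast
    have "(\<lambda>i. ip (T (s i)) h - ip (T f) h) \<longlonglongrightarrow> 0"
    proof (rule Lim_null_comparison)
      have "norm (ip (T (s i)) h - ip (T f) h) \<le> C * L2norm (\<lambda>z. s i z - f z) * L2norm h" for i
      proof -
        have "ip (T (s i)) h - ip (T f) h = ip (T (\<lambda>z. s i z - f z)) h"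
          using lin[of "s i" f 1 "-1"] limit by simp
        also have "norm \<dots> \<le> L2norm (T (\<lambda>z. s i z - f z)) * L2norm h"
          using limit by (intro Cauchy_Schwarz_ip T_L2 L2_diff h)
        also have "\<dots> \<le> C * L2norm (\<lambda>z. s i z - f z) * L2norm h"
          using limit by (intro mult_right_mono C L2_diff) (auto simp: L2norm_def)
        finally show ?thesis .
      qed
      then show "\<forall>\<^sub>F i in sequentially. norm (ip (T (s i)) h - ip (T f) h)
          \<le> C * L2norm (\<lambda>z. s i z - f z) * L2norm h" by simp
      show "(\<lambda>i. C * L2norm (\<lambda>z. s i z - f z) * L2norm h) \<longlonglongrightarrow> 0"
        using tendsto_mult_right[OF tendsto_mult_left[OF limit.hyps(3), of C], of "L2norm h"] by simp
    qed
    then have "(\<lambda>i. ip (T (s i)) h) \<longlonglongrightarrow> ip (T f) h" by (simp add: LIM_zero_iff)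
    moreover have "(\<lambda>i. ip (T (s i)) h) \<longlonglongrightarrow> ip f (\<lambda>z. h (z ^ k))"
      using tendsto_ip[OF limit.hyps(1,2) hk limit.hyps(3)] limit.IH by simp
    ultimately show ?case by (rule LIMSEQ_unique)
  }
qed

section \<open>Radial dilations and orthogonality to \<open>H2\<close>\<close>

text \<open>Replaces the radial limit by a limit along a sequence, as dominated convergence and the
  measurability of limits require.\<close>

definition radius :: "nat \<Rightarrow> real" where
  "radius i = 1 - inverse (real (Suc i))"

lemma radius_bounds: "0 \<le> radius i" "radius i < 1"
  by (auto simp: radius_def field_simps)

lemma filterlim_radius: "filterlim radius (at_left 1) sequentially"
proof -
  have "radius \<longlonglongrightarrow> 1 - 0"
    unfolding radius_def by (intro tendsto_intros LIMSEQ_inverse_real_of_nat)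
  then show ?thesis
    using radius_bounds by (auto simp: filterlim_at less_imp_neq)
qed

lemma continuous_on_dilation:
  assumes "F holomorphic_on ball 0 1" "0 \<le> r" "r < 1"
  shows "continuous_on (sphere 0 1) (\<lambda>z. F (complex_of_real r * z))"
  by (rule continuous_on_compose2[OF holomorphic_on_imp_continuous_on[OF assms(1)]])
    (use assms in \<open>auto intro!: continuous_intros simp: norm_mult\<close>)

text \<open>The Taylor series of \<open>F\<close> converges absolutely at radius \<open>r\<close>,
  so its partial sums on that circle are uniformly bounded and converge in \<open>L2\<close>;
  orthogonality passes from monomials to the limit.\<close>

lemma ip_dilation_eq_0:
  assumes F: "F holomorphic_on ball 0 1" and r: "0 \<le> r" "r < 1" and q: "q \<in> L2"
    and orth: "\<And>n::nat. ip (\<lambda>z. z ^ n) q = 0"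
  shows "ip (\<lambda>z. F (complex_of_real r * z)) q = 0"
proof -
  define a where "a n = (deriv ^^ n) F 0 / fact n" for n
  have sums: "(\<lambda>n. a n * w ^ n) sums F w" if "norm w < 1" for w
    using holomorphic_power_series[OF F, of w] that by (simp add: a_def)
  \<comment> \<open>Convergence at (1 + r) / 2, which lies strictly between \<open>r\<close> and 1,
    forces absolute convergence at \<open>r\<close>.\<close>
  have "summable (\<lambda>n. norm (a n * complex_of_real r ^ n))"
  proof (rule powser_insidea)
    have "norm (complex_of_real ((1 + r) / 2)) < 1" using r unfolding norm_of_real by simp
    then show "summable (\<lambda>n. a n * complex_of_real ((1 + r) / 2) ^ n)"
      using sums sums_summable by blast
    show "norm (complex_of_real r) < norm (complex_of_real ((1 + r) / 2))"
      using r unfolding norm_of_real by simp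
  qed
  then have summ: "summable (\<lambda>n. norm (a n) * r ^ n)"
    using r by (simp add: norm_mult norm_power)
  define B where "B = (\<Sum>n. norm (a n) * r ^ n)"
  define s where "s N z = (\<Sum>n<N. a n * (complex_of_real r * z) ^ n)" for N z
  have s_cont: "continuous_on S (s N)" for N S
    unfolding s_def by (intro continuous_intros)
  have F_cont: "continuous_on (sphere 0 1) (\<lambda>z. F (complex_of_real r * z))"
    using F r by (rule continuous_on_dilation)
  have B0: "B \<ge> 0" unfolding B_def using r by (intro suminf_nonneg summ) auto
  have bound: "norm (s N z) \<le> norm (complex_of_real B)" if "norm z = 1" for N z
  proof -
    have "norm (s N z) \<le> (\<Sum>n<N. norm (a n * (complex_of_real r * z) ^ n))"
      unfolding s_def by (rule norm_sum)
    also have "\<dots> = (\<Sum>n<N. norm (a n) * r ^ n)"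
      using that r by (simp add: norm_mult norm_power)
    also have "\<dots> \<le> B"
      unfolding B_def using r by (intro sum_le_suminf summ) auto
    finally show ?thesis using B0 by simp
  qed
  have lim: "(\<lambda>N. s N z) \<longlonglongrightarrow> F (complex_of_real r * z)" if "norm z = 1" for z
    using sums[of "complex_of_real r * z"] that r unfolding s_def sums_def by (simp add: norm_mult)
  have "(\<lambda>N. ip (s N) q) \<longlonglongrightarrow> ip (\<lambda>z. F (complex_of_real r * z)) q"
  proof (rule tendsto_ip)
    show "(\<lambda>N. L2norm (\<lambda>z. s N z - F (complex_of_real r * z))) \<longlonglongrightarrow> 0"
      by (rule L2_dominated_convergence(2)[OF _ L2_const[of "complex_of_real B"]])
        (use s_cont F_cont bound lim in \<open>auto intro: L2_continuous_on continuous_on_measurable_circ\<close>)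
  qed (use s_cont F_cont q in \<open>auto intro: L2_continuous_on\<close>)
  moreover have "ip (s N) q = 0" for N
  proof (induction N)
    case 0
    then show ?case by (simp add: s_def ip_def)
  next
    case (Suc N)
    have "ip (s (Suc N)) q = ip (\<lambda>z. s N z + a N * of_real r ^ N * z ^ N) q"
      by (simp add: s_def[abs_def] power_mult_distrib mult.assoc)
    also have "\<dots> = ip (s N) q + ip (\<lambda>z. a N * of_real r ^ N * z ^ N) q"
      by (intro ip_add L2_continuous_on s_cont q continuous_intros)
    also have "\<dots> = 0" using Suc orth by (simp add: ip_cmult)
    finally show ?case .
  qed
  ultimately show ?thesis by (simp add: LIMSEQ_const_iff)
qed

lemma H2_E:
  assumes "f \<in> H2"
  obtains F C where "f \<in> L2" "F holomorphic_on ball 0 1"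
    "\<And>r. r \<in> {0..<1::real} \<Longrightarrow> (\<integral>z. (norm (F (of_real r * z)))\<^sup>2 \<partial>circ) \<le> C"
    "AE z in circ. ((\<lambda>r. F (of_real r * z)) \<longlongrightarrow> f z) (at_left (1::real))"
  using assms unfolding H2_def has_boundary_function_def by blast

lemma H2_const: "(\<lambda>z. c) \<in> H2"
  unfolding H2_def has_boundary_function_def using L2_const[of c]
  by (auto intro!: exI[of _ "\<lambda>_. c"])

lemma eventually_at_left_1: "\<forall>\<^sub>F r in at_left (1::real). 0 < r \<and> r < 1"
  unfolding eventually_at_left_field by (intro exI[of _ 0]) auto

text \<open>The dilations of \<open>F\<close> are bounded in \<open>L2\<close> and tend to
  \<open>f\<close> almost everywhere, hence weakly, and each of them is orthogonal to
  \<open>q\<close> by its Taylor series. In the main proof this replaces an \<open>H2\<close> factor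
  by monomials.\<close>

lemma ip_H2_eq_0:
  assumes f: "f \<in> H2" and q: "q \<in> L2" and orth: "\<And>n::nat. ip (\<lambda>z. z ^ n) q = 0"
  shows "ip f q = 0"
proof -
  obtain F C where F: "F holomorphic_on ball 0 1"
    and C: "\<And>r. r \<in> {0..<1::real} \<Longrightarrow> (\<integral>z. (norm (F (of_real r * z)))\<^sup>2 \<partial>circ) \<le> C"
    and lim: "AE z in circ. ((\<lambda>r. F (of_real r * z)) \<longlongrightarrow> f z) (at_left (1::real))"
    and f2: "f \<in> L2"
    using f by (rule H2_E) blast
  have "(\<lambda>i. ip (\<lambda>z. F (of_real (radius i) * z)) q) \<longlonglongrightarrow> ip f q"
  proof (rule bounded_AE_imp_weak_convergence[OF _ f2 q])
    show "(\<lambda>z. F (of_real (radius i) * z)) \<in> L2" for i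
      using F radius_bounds by (intro L2_continuous_on continuous_on_dilation)
    show "(\<integral>z. (norm (F (of_real (radius i) * z)))\<^sup>2 \<partial>circ) \<le> C" for i
      using radius_bounds[of i] by (intro C) simp
    show "AE z in circ. (\<lambda>i. F (of_real (radius i) * z)) \<longlonglongrightarrow> f z"
      using lim by eventually_elim (rule filterlim_compose[OF _ filterlim_radius])
  qed
  moreover have "ip (\<lambda>z. F (of_real (radius i) * z)) q = 0" for i
    using F radius_bounds q orth by (rule ip_dilation_eq_0)
  ultimately show ?thesis by (simp add: LIMSEQ_const_iff)
qed

section \<open>Boundary values of inner and bounded functions, and substitution of z^k in
  \<open>H2\<close>\<close>

text \<open>\<open>bdry \<alpha>\<close> is unspecified where the radial limit fails to exist, so
  its measurability is not evident. The limit along \<open>radius\<close> of continuous functions is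
  measurable and agrees with it wherever the radial limit exists.\<close>

lemma inner_function_bdry_representative:
  assumes "inner_function \<alpha>"
  obtains a where "a \<in> borel_measurable circ" "AE z in circ. a z = bdry \<alpha> z"
    "AE z in circ. norm (a z) = 1"
proof
  define a where "a z = lim (\<lambda>i. \<alpha> (of_real (radius i) * z))" for z
  have \<alpha>: "\<alpha> holomorphic_on ball 0 1"
    "AE z in circ. \<exists>w. norm w = 1 \<and> ((\<lambda>r. \<alpha> (of_real r * z)) \<longlongrightarrow> w) (at_left (1::real))"
    using assms by (auto simp: inner_function_def)
  show "a \<in> borel_measurable circ"
    unfolding a_def using \<alpha> radius_bounds
    by (intro borel_measurable_lim_metric continuous_on_measurable_circ continuous_on_dilation)
  have "AE z in circ. a z = bdry \<alpha> z \<and> norm (a z) = 1"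
    using \<alpha>(2)
  proof eventually_elim
    case (elim z)
    then obtain w where w: "norm w = 1" "((\<lambda>r. \<alpha> (of_real r * z)) \<longlongrightarrow> w) (at_left (1::real))"
      by blast
    have "a z = w"
      unfolding a_def by (rule limI[OF filterlim_compose[OF w(2) filterlim_radius]])
    moreover have "bdry \<alpha> z = w"
      unfolding bdry_def by (rule tendsto_Lim[OF _ w(2)]) simp
    ultimately show ?case using w by simp
  qed
  then show "AE z in circ. a z = bdry \<alpha> z" "AE z in circ. norm (a z) = 1" by auto
qed

lemma Hinf_AE_bounded:
  assumes "f \<in> Hinf"
  obtains B where "AE z in circ. norm (f z) \<le> B"
proof -
  obtain F where bdd: "bounded (F ` ball 0 1)"
    and lim: "AE z in circ. ((\<lambda>r. F (of_real r * z)) \<longlongrightarrow> f z) (at_left (1::real))"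
    using assms by (auto simp: Hinf_def has_boundary_function_def)
  obtain B where B: "\<And>z. norm z < 1 \<Longrightarrow> norm (F z) \<le> B"
    using bdd unfolding bounded_iff by (metis imageI mem_ball_0)
  have "AE z in circ. norm (f z) \<le> B"
    using lim AE_space
  proof eventually_elim
    case (elim z)
    have "\<forall>\<^sub>F r in at_left (1::real). norm (F (of_real r * z)) \<le> B"
      using eventually_at_left_1 by eventually_elim (use elim in \<open>auto intro!: B simp: norm_mult\<close>)
    then show ?case by (rule tendsto_upperbound[OF tendsto_norm[OF elim(1)]]) simp
  qed
  then show ?thesis by (rule that)
qed

text \<open>The witness is z^n H(z^k). Its quadratic mean at radius \<open>r\<close> is at most that
  of \<open>H\<close> at radius r^k, by invariance of the measure under z -> z^k.\<close>

lemma H2_power_mult_compose_power: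
  assumes h: "h \<in> H2" and k: "k \<ge> 1"
  shows "(\<lambda>z. z ^ n * h (z ^ k)) \<in> H2"
proof -
  obtain H C where H: "H holomorphic_on ball 0 1"
    and C: "\<And>r. r \<in> {0..<1::real} \<Longrightarrow> (\<integral>z. (norm (H (of_real r * z)))\<^sup>2 \<partial>circ) \<le> C"
    and lim: "AE z in circ. ((\<lambda>r. H (of_real r * z)) \<longlongrightarrow> h z) (at_left (1::real))"
    and h2: "h \<in> L2"
    using h by (rule H2_E) blast
  define G where "G z = z ^ n * H (z ^ k)" for z
  have pow_lt: "x ^ k < 1" if "0 \<le> x" "x < 1" for x :: real
    using that k power_strict_mono[of x 1 k] by simp
  have G: "G holomorphic_on ball 0 1"
    unfolding G_def
    by (intro holomorphic_intros holomorphic_on_compose_gen[OF _ H, unfolded o_def])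
      (auto simp: norm_power pow_lt)
  have "(\<integral>z. (norm (G (of_real r * z)))\<^sup>2 \<partial>circ) \<le> C" if r: "r \<in> {0..<1::real}" for r
  proof -
    have rk: "r ^ k \<in> {0..<1}" using r pow_lt by auto
    have L2: "(\<lambda>z. H (of_real (r ^ k) * z)) \<in> L2"
      using rk by (intro L2_continuous_on continuous_on_dilation H) auto
    have "(\<integral>z. (norm (G (of_real r * z)))\<^sup>2 \<partial>circ) \<le> (\<integral>z. (norm (H (of_real (r ^ k) * z ^ k)))\<^sup>2 \<partial>circ)"
    proof (rule integral_mono)
      show "integrable circ (\<lambda>z. (norm (G (of_real r * z)))\<^sup>2)"
        using r by (intro L2_integrable L2_continuous_on continuous_on_dilation G) auto
      show "integrable circ (\<lambda>z. (norm (H (of_real (r ^ k) * z ^ k)))\<^sup>2)"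
        by (rule L2_integrable[OF L2_power[OF k L2]])
      fix z assume z: "z \<in> space circ"
      have "norm (G (of_real r * z)) = r ^ n * norm (H (of_real (r ^ k) * z ^ k))"
        using r z by (simp add: G_def norm_mult norm_power power_mult_distrib)
      also have "\<dots> \<le> 1 * norm (H (of_real (r ^ k) * z ^ k))"
        using r by (intro mult_right_mono power_le_one) auto
      finally show "(norm (G (of_real r * z)))\<^sup>2 \<le> (norm (H (of_real (r ^ k) * z ^ k)))\<^sup>2"
        by (intro power_mono) auto
    qed
    also have "\<dots> = (\<integral>z. (norm (H (of_real (r ^ k) * z)))\<^sup>2 \<partial>circ)"
      using L2_integrable[OF L2]
      by (intro integral_circ_power[OF k, of "\<lambda>z. (norm (H (of_real (r ^ k) * z)))\<^sup>2"]) auto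
    also have "\<dots> \<le> C" using rk by (rule C)
    finally show ?thesis .
  qed
  moreover have "AE z in circ. ((\<lambda>r. G (of_real r * z)) \<longlongrightarrow> z ^ n * h (z ^ k)) (at_left (1::real))"
    using AE_circ_power[OF k lim]
  proof eventually_elim
    case (elim z)
    \<comment> \<open>Along the radius to \<open>z\<close>, the argument of \<open>H\<close> runs
      along the radius to z^k with parameter r^k, which also tends to 1 from below.\<close>
    have "filterlim (\<lambda>r::real. r ^ k) (at_left 1) (at_left 1)"
      unfolding filterlim_at
    proof
      have "((\<lambda>r::real. r ^ k) \<longlongrightarrow> 1 ^ k) (at_left 1)" by (intro tendsto_intros)
      then show "((\<lambda>r::real. r ^ k) \<longlongrightarrow> 1) (at_left 1)" by simp
    show "\<forall>\<^sub>F r in at_left (1::real). r ^ k \<in> {..<1} \<and> r ^ k \<noteq> 1"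
      using eventually_at_left_1 by eventually_elim (auto dest!: pow_lt[OF less_imp_le])
    qed
    then have "((\<lambda>r. H (of_real (r ^ k) * z ^ k)) \<longlongrightarrow> h (z ^ k)) (at_left 1)"
      by (rule filterlim_compose[OF elim])
    then have "((\<lambda>r. (of_real r * z) ^ n * H (of_real (r ^ k) * z ^ k))
        \<longlongrightarrow> (of_real 1 * z) ^ n * h (z ^ k)) (at_left 1)"
      by (intro tendsto_intros)
    then show ?case by (simp add: G_def power_mult_distrib)
  qed
  moreover have "(\<lambda>z. z ^ n * h (z ^ k)) \<in> L2"
  proof (rule L2_mult_bounded[where B = 1])
    show "(\<lambda>z. h (z ^ k)) \<in> L2" using k h2 by (rule L2_power)
    show "(\<lambda>z::complex. z ^ n) \<in> borel_measurable circ"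
      by (intro continuous_on_measurable_circ continuous_intros)
  qed (auto simp: norm_power)
  ultimately show ?thesis
    using G unfolding H2_def has_boundary_function_def by blast
qed

section \<open>The spaces \<open>K\<close> and their projections\<close>

lemma K_L2: "f \<in> K \<alpha> \<Longrightarrow> f \<in> L2"
  by (simp add: K_def H2_def)

text \<open>Membership in \<open>mult_H2\<close> demands a function in \<open>L2\<close>, which the
  measurable unimodular representative \<open>a\<close> provides in place of
  \<open>bdry \<alpha>\<close>.\<close>

lemma K_orthogonal:
  assumes a: "a \<in> borel_measurable circ" "AE z in circ. a z = bdry \<alpha> z" "AE z in circ. norm (a z) = 1"
    and f: "f \<in> K \<alpha>" and h: "h \<in> H2"
  shows "ip f (\<lambda>z. a z * h z) = 0"
proof -
  have "(\<lambda>z. a z * h z) \<in> L2"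
    using a(3) by (intro L2_mult_bounded[where B = 1] a(1)) (use h in \<open>auto simp: H2_def elim: AE_mp\<close>)
  moreover have "AE z in circ. a z * h z = bdry \<alpha> z * h z" using a(2) by auto
  ultimately have "(\<lambda>z. a z * h z) \<in> mult_H2 (bdry \<alpha>)" using h unfolding mult_H2_def by blast
  then show ?thesis using f by (simp add: K_def)
qed

text \<open>The zero function satisfies the condition under \<open>SOME\<close>, so the chosen p
  does too. Then p lies in \<open>K \<beta>\<close> and both g and g - p are orthogonal to it,
  whence p is orthogonal to itself.\<close>

lemma proj_K_eq_0:
  assumes g: "g \<in> L2" and orth: "\<And>h. h \<in> K \<beta> \<Longrightarrow> ip g h = 0"
  shows "AE z in circ. proj (K \<beta>) g z = 0"
proof -
  have "(\<lambda>z. 0) \<in> K \<beta>" by (simp add: K_def ip_def H2_const)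
  then have "\<exists>p. p \<in> K \<beta> \<and> (\<forall>h\<in>K \<beta>. ip (\<lambda>z. g z - p z) h = 0)"
    using orth by (intro exI[of _ "\<lambda>z. 0"]) simp
  then have p: "proj (K \<beta>) g \<in> K \<beta>"
    "\<And>h. h \<in> K \<beta> \<Longrightarrow> ip (\<lambda>z. g z - proj (K \<beta>) g z) h = 0"
    unfolding proj_def by (rule someI2_ex; blast)+
  have "ip g (proj (K \<beta>) g) - ip (proj (K \<beta>) g) (proj (K \<beta>) g) = 0"
    using p(2)[OF p(1)] g K_L2[OF p(1)] by (simp add: ip_diff)
  then show ?thesis
    using orth[OF p(1)] K_L2[OF p(1)] by (intro ip_self_eq_0) auto
qed

section \<open>Orthogonality of both summands of the symbol\<close>

theorem proposition2p7:
  fixes k :: nat and \<alpha> \<beta> \<phi> :: "complex \<Rightarrow> complex"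
  assumes "k \<ge> 1"
    and "inner_function \<alpha>" and "inner_function \<beta>"
    and "\<phi> \<in> L2"
    and "\<exists>u\<in>mult_H2 (bdry \<alpha>). \<exists>v\<in>mult_H2 (\<lambda>z. cnj z ^ (k - 1) * W_adj k (bdry \<beta>) z).
           AE z in circ. \<phi> z = cnj (u z) + v z"
  shows "\<forall>f\<in>Kinf \<alpha>. AE z in circ. U k \<beta> \<phi> f z = 0"
proof
  fix f assume "f \<in> Kinf \<alpha>"
  then have f: "f \<in> K \<alpha>" "f \<in> H2" "f \<in> Hinf" "f \<in> L2" by (auto simp: Kinf_def K_def H2_def)
  note k = assms(1)
  obtain u v h1 h2 where uv: "u \<in> L2" "v \<in> L2" and h1: "h1 \<in> H2" and h2: "h2 \<in> H2"
    and u_eq: "AE z in circ. u z = bdry \<alpha> z * h1 z"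
    and v_eq: "AE z in circ. v z = cnj z ^ (k - 1) * bdry \<beta> (z ^ k) * h2 z"
    and \<phi>_eq: "AE z in circ. \<phi> z = cnj (u z) + v z"
    using assms(5) by (auto simp: mult_H2_def W_adj_def)
  have h12_L2: "h1 \<in> L2" "h2 \<in> L2" using h1 h2 by (auto simp: H2_def)
  obtain a where a: "a \<in> borel_measurable circ" "AE z in circ. a z = bdry \<alpha> z"
    "AE z in circ. norm (a z) = 1"
    using inner_function_bdry_representative[OF assms(2)] .
  obtain b where b: "b \<in> borel_measurable circ" "AE z in circ. b z = bdry \<beta> z"
    "AE z in circ. norm (b z) = 1"
    using inner_function_bdry_representative[OF assms(3)] .
  obtain B where B: "AE z in circ. norm (f z) \<le> B" using Hinf_AE_bounded[OF f(3)] .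
  have [measurable]: "a \<in> borel_measurable circ" "b \<in> borel_measurable circ"
    "f \<in> borel_measurable circ" "h1 \<in> borel_measurable circ" "h2 \<in> borel_measurable circ"
    "u \<in> borel_measurable circ" "v \<in> borel_measurable circ" "\<phi> \<in> borel_measurable circ"
    using a b f uv h12_L2 assms(4) by (auto dest: L2_measurable)
  have \<phi>f: "(\<lambda>z. \<phi> z * f z) \<in> L2"
    using L2_mult_bounded[OF assms(4) _ B] by (simp add: mult.commute)
  have "ip (\<lambda>z. \<phi> z * f z) (\<lambda>z. h (z ^ k)) = 0" if h: "h \<in> K \<beta>" for h
  proof -
    have hH2: "h \<in> H2" and h_L2: "h \<in> L2" using h by (auto simp: K_def H2_def)
    have hk: "(\<lambda>z. h (z ^ k)) \<in> L2" using k h_L2 by (rule L2_power)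
    have [measurable]: "h \<in> borel_measurable circ" using h_L2 by (rule L2_measurable)
    \<comment> \<open>\<open>q1\<close> and \<open>q2\<close> gather all factors except
      \<open>h1\<close> and \<open>h2\<close> in the two pairings, which become cnj (ip h1 q1) and
      ip h2 q2. They are in \<open>L2\<close> because \<open>f\<close> is bounded.\<close>
    define q1 where "q1 z = (cnj (a z) * f z) * cnj (h (z ^ k))" for z
    \<comment> \<open>On the circle cnj z ^ (k - 1) equals z powi (1 - k), so \<open>c\<close> is
      the multiplier of \<open>h2\<close> with \<open>b\<close> in place of
      \<open>bdry \<beta>\<close>.\<close>
    define c where "c z = z powi (1 - int k) * b (z ^ k)" for z
    define q2 where "q2 z = (cnj (c z) * cnj (f z)) * h (z ^ k)" for z
    have c_meas [measurable]: "c \<in> borel_measurable circ" unfolding c_def by measurable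
    have c_norm: "AE z in circ. norm (c z) \<le> 1"
      using AE_circ_power[OF k b(3)] AE_space
      by eventually_elim (simp add: c_def norm_mult norm_power_int)
    have af: "AE z in circ. norm (cnj (a z) * f z) \<le> B"
      using B a(3) by eventually_elim (simp add: norm_mult)
    have q1: "q1 \<in> L2" unfolding q1_def by (rule L2_mult_bounded[OF L2_cnj[OF hk] _ af]) measurable
    have cf: "AE z in circ. norm (cnj (c z) * cnj (f z)) \<le> B"
      using B c_norm
    proof eventually_elim
      case (elim z)
      have "norm (c z) * norm (f z) \<le> 1 * norm (f z)" using elim by (intro mult_right_mono) auto
      then show ?case using elim by (simp add: norm_mult)
    qed
    have q2: "q2 \<in> L2" unfolding q2_def by (rule L2_mult_bounded[OF hk _ cf]) measurable
    have q1_0: "ip h1 q1 = 0"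
    proof (rule ip_H2_eq_0[OF h1 q1])
      fix n :: nat
      \<comment> \<open>With a monomial for \<open>h1\<close>, the factor z^n h(z^k) is in
        \<open>H2\<close>, and \<open>f\<close> is orthogonal to its product with
        \<open>a\<close>.\<close>
      have "ip (\<lambda>z. z ^ n) q1 = cnj (ip f (\<lambda>z. a z * (z ^ n * h (z ^ k))))"
        unfolding ip_def q1_def by (simp flip: Bochner_Integration.integral_cnj add: ac_simps)
      also have "\<dots> = 0"
        using K_orthogonal[OF a f(1) H2_power_mult_compose_power[OF hH2 k]] by simp
      finally show "ip (\<lambda>z. z ^ n) q1 = 0" .
    qed
    have q2_0: "ip h2 q2 = 0"
    proof (rule ip_H2_eq_0[OF h2 q2])
      fix n :: nat
      \<comment> \<open>Once \<open>h2\<close> is a monomial, \<open>f\<close> is moved to the left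
        slot; as a member of \<open>H2\<close> it can then be replaced by monomials in turn.\<close>
      define q3 where "q3 z = cnj (z ^ n * c z) * h (z ^ k)" for z
      have "AE z in circ. norm (cnj (z ^ n * c z)) \<le> 1"
        using c_norm AE_space by eventually_elim (simp add: norm_mult norm_power)
      moreover have "(\<lambda>z. cnj (z ^ n * c z)) \<in> borel_measurable circ"
        using measurable_powi_circ[of "int n"] by (intro measurable_cnj borel_measurable_times) auto
      ultimately have q3: "q3 \<in> L2" unfolding q3_def by (intro L2_mult_bounded[OF hk]) auto
      have "ip (\<lambda>z. z ^ n) q2 = ip f q3"
        unfolding ip_def q2_def q3_def by (simp add: ac_simps)
      also have "\<dots> = 0"
      proof (rule ip_H2_eq_0[OF f(2) q3])
        fix m :: nat
        define Q where "Q z = b z * cnj (h z)" for z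
        define j where "j = int m + int n + 1 - int k"
        have "integrable circ Q"
          unfolding Q_def using b(3)
          by (intro L2_mult_integrable L2_bounded[of b 1] L2_cnj h_L2 b(1)) (auto elim: AE_mp)
        have "ip (\<lambda>z. z ^ m) q3 = (\<integral>z. z powi j * Q (z ^ k) \<partial>circ)"
          unfolding ip_def
        proof (rule Bochner_Integration.integral_cong[OF refl])
          fix z assume "z \<in> space circ"
          then have "z \<noteq> 0" by auto
          then have "z powi j = z ^ m * (z ^ n * z powi (1 - int k))"
            by (simp add: j_def power_int_add power_int_diff)
          then show "z ^ m * cnj (q3 z) = z powi j * Q (z ^ k)"
            by (simp add: q3_def c_def Q_def ac_simps)
        qed
        also have "\<dots> = 0"
        proof (cases "int k dvd j")
          case True
          then obtain i where i: "j = int k * i" by auto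
          \<comment> \<open>Here the exponent k - 1 matters: j >= 1 - k > -k excludes i <= -1,
            whereas with exponent k the case m = n = 0 would give i = -1.\<close>
          have "i \<ge> 0"
          proof (rule ccontr)
            assume "\<not> i \<ge> 0"
            then have "int k * i \<le> int k * (-1)" by (intro mult_left_mono) auto
            then show False using i by (simp add: j_def)
          qed
          then obtain l where l: "i = int l" by (metis nonneg_int_cases)
          have "(\<integral>z. z powi j * Q (z ^ k) \<partial>circ) = (\<integral>z. z ^ l * Q z \<partial>circ)"
            using k True by (simp add: integral_powi_mult_power[OF k \<open>integrable circ Q\<close>] i l)
          \<comment> \<open>The factor 1 puts z^l into the shape of
            \<open>H2_power_mult_compose_power\<close> for a constant function and power 1, which
            shows that z^l is in \<open>H2\<close>.\<close>
          also have "\<dots> = cnj (ip h (\<lambda>z. b z * (z ^ l * 1)))"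
            unfolding ip_def Q_def by (simp flip: Bochner_Integration.integral_cnj add: ac_simps)
          also have "\<dots> = 0"
            using K_orthogonal[OF b h] H2_power_mult_compose_power[OF H2_const[of 1], of 1 l] by simp
          finally show ?thesis .
        next
          case False
          then show ?thesis by (simp add: integral_powi_mult_power[OF k \<open>integrable circ Q\<close>])
        qed
        finally show "ip (\<lambda>z. z ^ m) q3 = 0" .
      qed
      finally show "ip (\<lambda>z. z ^ n) q2 = 0" .
    qed
    have [measurable]: "q1 \<in> borel_measurable circ" "q2 \<in> borel_measurable circ"
      using q1 q2 by (auto dest: L2_measurable)
    have "ip (\<lambda>z. \<phi> z * f z) (\<lambda>z. h (z ^ k)) = (\<integral>z. cnj (h1 z * cnj (q1 z)) + h2 z * cnj (q2 z) \<partial>circ)"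
      unfolding ip_def
    proof (rule integral_cong_AE)
      show "AE z in circ. \<phi> z * f z * cnj (h (z ^ k)) = cnj (h1 z * cnj (q1 z)) + h2 z * cnj (q2 z)"
        \<comment> \<open>The representative \<open>b\<close> equals \<open>bdry \<beta>\<close>
          only almost everywhere and is evaluated at z^k, so the equality is pulled back by
          \<open>AE_circ_power\<close>.\<close>
        using u_eq v_eq \<phi>_eq a(2) AE_circ_power[OF k b(2)] AE_space
      proof eventually_elim
        case (elim z)
        have "z * cnj z = 1" using elim(6) by (simp flip: complex_norm_square)
        then have "cnj z = inverse z" by (metis inverse_unique)
        then have "cnj z ^ (k - 1) = z powi (- int (k - 1))"
          by (simp add: power_int_minus power_inverse)
        also have "- int (k - 1) = 1 - int k" using k by simp
        finally show ?case
          using elim by (simp add: q1_def q2_def c_def algebra_simps)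
      qed
    qed measurable
    also have "\<dots> = cnj (ip h1 q1) + ip h2 q2"
      unfolding ip_def using ip_integrable[OF h12_L2(1) q1] ip_integrable[OF h12_L2(2) q2]
      by (subst Bochner_Integration.integral_add) (auto simp del: complex_cnj_mult)
    finally show ?thesis using q1_0 q2_0 by simp
  qed
  then have "ip (W k (\<lambda>z. \<phi> z * f z)) h = 0" if "h \<in> K \<beta>" for h
    using is_W_adjoint[OF k is_W_W[OF k] \<phi>f K_L2[OF that]] that by simp
  moreover have "W k (\<lambda>z. \<phi> z * f z) \<in> L2"
    using is_W_W[OF k] \<phi>f by (auto simp: is_W_def bounded_L2_operator_def)
  ultimately show "AE z in circ. U k \<beta> \<phi> f z = 0"
    unfolding U_def by (intro proj_K_eq_0)
qed

end
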